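(* Let $(\mathcal{X},\mathcal{Y},\{W(y|x):x\in\mathcal{X},y\in\mathcal{Y}\})$ be an output symmetric discrete memoryless channel with capacity $C$ and channel dispersion $\nu>0$, and let $T$ be a positive integer. Consider sequences $M_n$ and $S_n$ such that $\log M_n=nC-n^{1-t}$ and $S_n=\omega(n^t)\cap\exp\{o(n^{1-2t})\}$ for $0<t<\frac13$. Then $$\lim_{n\to\infty}-\frac{1}{n^{1-2t}}\log\epsilon^*(n,M_n,T,S_n)=\frac{T}{2\nu}.$$
   Context: Conventions: all logs are to base 2. $[i:j]=\{i,i+1,\dots,j\}$; $x^j=(x_1,\dots,x_j)$. Asymptotic notations $o(\cdot),\omega(\cdot)$ are the usual ones, with the additional restriction that the sequences in them are positive; $S_n=\omega(n^t)\cap\exp\{o(n^{1-2t})\}$ means that both $S_n=\omega(n^t)$ and $S_n=\exp\{o(n^{1-2t})\}$ hold (the base of $\exp$ is immaterial here). Channel: $\mathcal{X},\mathcal{Y}$ are finite sets and $W(\cdot|x)$ is a probability distribution on $\mathcal{Y}$ for each $x\in\mathcal{X}$. Channel uses are memoryless, without feedback. The channel is output symmetric (Gallager) if $\mathcal{Y}$ can be partitioned into disjoint subsets in such a way that for each subset the matrix of transition probabilities (rows indexed by $\mathcal{X}$, columns by the outputs in the subset) has the property that each row is a permutation of each other row and each column is a permutation of each other column. For a distribution $P$ on $\mathcal{X}$, let $PW(y)=\sum_x P(x)W(y|x)$, $i(x;y)=\log\frac{W(y|x)}{PW(y)}$, $I(P,W)=\sum_{x,y}P(x)W(y|x)\,i(x;y)$,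 and $V(P,W)=\mathrm{E}[\mathrm{Var}[i(X;Y)|X]]$ with $X\sim P$, $Y|X\sim W$. Capacity: $C=\max_P I(P,W)$. Dispersion: $\nu=\min_{P:I(P,W)=C}V(P,W)$. Streaming code: an $(n,M,\epsilon,T,S)$-streaming code consists of (i) independent messages $G_1,\dots,G_S$, each uniform on $\mathcal{G}=[1:M]$; (ii) encoding functions $\phi_k:\mathcal{G}^{\min\{k,S\}}\to\mathcal{X}^n$, $k\in[1:S+T-1]$, giving the codeword $\mathbf{X}_k=\phi_k(G^{\min\{k,S\}})$ sent in block $k$ ($n$ channel uses), with output $\mathbf{Y}_k\in\mathcal{Y}^n$; (iii) decoding functions $\psi_k:\mathcal{Y}^{(k+T-1)n}\to\mathcal{G}$, $k\in[1:S]$, giving $\hat G_k=\psi_k(\mathbf{Y}_1,\dots,\mathbf{Y}_{k+T-1})$; such that $\max_{k\in[1:S]}\Pr(\hat G_k\ne G_k)\le\epsilon$. $\epsilon^*(n,M,T,S)=\inf\{\epsilon:\text{ there exists an }(n,M,\epsilon,T,S)\text{-streaming code}\}$.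
   Formalization: With all logs to base 2 the limit T/(2ν) lacks a factor log e (it fails e.g. for any noisy BSC); for logs to any base b>1 the limit proved is (T/(2ν))·log_b(e), which is T/(2ν) for natural logs. log M_n = nC − n^{1−t} is read up to rounding M_n to an integer. *)

theory Defs
  imports
    "HOL-Probability.Probability"
    "HOL-Combinatorics.Permutations"
    "HOL-Library.Disjoint_Sets"
    "HOL-Library.Landau_Symbols"
begin

text \<open>
  A channel is a function from input letters to distributions on output letters. The base
  \<open>b > 1\<close> of the logarithms is a parameter of every information quantity: \<open>b = 2\<close> measures
  in bits, \<open>b = exp 1\<close> in nats.
\<close>

definition output_symmetric :: "('x::finite \<Rightarrow> 'y::finite pmf) \<Rightarrow> bool" where
  "output_symmetric W \<longleftrightarrow>
     (\<exists>\<P>. partition_on UNIV \<P> \<and>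
       (\<forall>B\<in>\<P>.
          (\<forall>x x'. \<exists>\<pi>. \<pi> permutes B \<and> (\<forall>y\<in>B. pmf (W x') y = pmf (W x) (\<pi> y))) \<and>
          (\<forall>y\<in>B. \<forall>y'\<in>B. \<exists>\<pi>. \<pi> permutes UNIV \<and> (\<forall>x. pmf (W x) y' = pmf (W (\<pi> x)) y))))"

text \<open>
  \<open>bind_pmf P W\<close> is the output distribution \<open>PW\<close>. Where \<open>W(y|x) = 0\<close> or \<open>P(x) = 0\<close> the
  value of the information density is irrelevant: it enters below with weight \<open>0\<close>.
\<close>

definition info_density :: "real \<Rightarrow> ('x::finite \<Rightarrow> 'y::finite pmf) \<Rightarrow> 'x pmf \<Rightarrow> 'x \<Rightarrow> 'y \<Rightarrow> real" where
  "info_density b W P x y = log b (pmf (W x) y / pmf (bind_pmf P W) y)"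

definition mutual_info :: "real \<Rightarrow> ('x::finite \<Rightarrow> 'y::finite pmf) \<Rightarrow> 'x pmf \<Rightarrow> real" where
  "mutual_info b W P = (\<Sum>x\<in>UNIV. \<Sum>y\<in>UNIV. pmf P x * pmf (W x) y * info_density b W P x y)"

definition cond_info_variance :: "real \<Rightarrow> ('x::finite \<Rightarrow> 'y::finite pmf) \<Rightarrow> 'x pmf \<Rightarrow> real" where
  "cond_info_variance b W P =
     measure_pmf.expectation P (\<lambda>x. measure_pmf.variance (W x) (info_density b W P x))"

text \<open>
  The supremum and the infimum are a maximum and a minimum: both functions are continuous in
  \<open>P\<close>, which ranges over a compact simplex (for the infimum, over a closed subset of it on which
  the output distribution is constant).
\<close>

definition capacity :: "real \<Rightarrow> ('x::finite \<Rightarrow> 'y::finite pmf) \<Rightarrow> real" where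
  "capacity b W = (SUP P. mutual_info b W P)"

definition dispersion :: "real \<Rightarrow> ('x::finite \<Rightarrow> 'y::finite pmf) \<Rightarrow> real" where
  "dispersion b W = (INF P\<in>{P. mutual_info b W P = capacity b W}. cond_info_variance b W P)"

text \<open>Memoryless use of the channel on a finite input word.\<close>

primrec dmc :: "('x \<Rightarrow> 'y pmf) \<Rightarrow> 'x list \<Rightarrow> 'y list pmf" where
  "dmc W [] = return_pmf []"
| "dmc W (x # xs) =
     bind_pmf (W x) (\<lambda>y. bind_pmf (dmc W xs) (\<lambda>ys. return_pmf (y # ys)))"

text \<open>
  Joint law of the messages \<open>G\<^sub>1, \<dots>, G\<^sub>S\<close> (a list, so \<open>G\<^sub>k\<close> is entry \<open>k - 1\<close>) and of the
  concatenation of the output blocks \<open>1, \<dots>, S + T - 1\<close>.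
\<close>

definition streaming_joint ::
  "('x \<Rightarrow> 'y pmf) \<Rightarrow> nat \<Rightarrow> nat \<Rightarrow> nat \<Rightarrow> (nat \<Rightarrow> nat list \<Rightarrow> 'x list) \<Rightarrow> (nat list \<times> 'y list) pmf" where
  "streaming_joint W M T S \<phi> =
     bind_pmf (replicate_pmf S (pmf_of_set {1..M})) (\<lambda>g.
       bind_pmf (dmc W (concat (map (\<lambda>k. \<phi> k (take (min k S) g)) [1..<S + T]))) (\<lambda>ys.
         return_pmf (g, ys)))"

definition streaming_error ::
  "('x \<Rightarrow> 'y pmf) \<Rightarrow> nat \<Rightarrow> nat \<Rightarrow> nat \<Rightarrow> nat \<Rightarrow> (nat \<Rightarrow> nat list \<Rightarrow> 'x list) \<Rightarrow>
     (nat \<Rightarrow> 'y list \<Rightarrow> nat) \<Rightarrow> nat \<Rightarrow> real" where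
  "streaming_error W n M T S \<phi> \<psi> k =
     measure_pmf.prob (streaming_joint W M T S \<phi>)
       {(g, ys). \<psi> k (take ((k + T - 1) * n) ys) \<noteq> g ! (k - 1)}"

definition streaming_code ::
  "('x \<Rightarrow> 'y pmf) \<Rightarrow> nat \<Rightarrow> nat \<Rightarrow> real \<Rightarrow> nat \<Rightarrow> nat \<Rightarrow> (nat \<Rightarrow> nat list \<Rightarrow> 'x list) \<Rightarrow>
     (nat \<Rightarrow> 'y list \<Rightarrow> nat) \<Rightarrow> bool" where
  "streaming_code W n M \<epsilon> T S \<phi> \<psi> \<longleftrightarrow>
     1 \<le> M \<and> 1 \<le> T \<and> 1 \<le> S \<and>
     (\<forall>k\<in>{1..S + T - 1}. \<forall>g. length g = min k S \<and> set g \<subseteq> {1..M} \<longrightarrow> length (\<phi> k g) = n) \<and>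
     (\<forall>k\<in>{1..S}. \<forall>ys. length ys = (k + T - 1) * n \<longrightarrow> \<psi> k ys \<in> {1..M}) \<and>
     (MAX k\<in>{1..S}. streaming_error W n M T S \<phi> \<psi> k) \<le> \<epsilon>"

definition optimal_error ::
  "('x \<Rightarrow> 'y pmf) \<Rightarrow> nat \<Rightarrow> nat \<Rightarrow> nat \<Rightarrow> nat \<Rightarrow> real" where
  "optimal_error W n M T S = Inf {\<epsilon>. \<exists>\<phi> \<psi>. streaming_code W n M \<epsilon> T S \<phi> \<psi>}"

end

theory Submission
  imports Defs "HOL-Real_Asymp.Real_Asymp"
begin

text \<open>
  By output symmetry, the law of the information density \<open>ln (W(y|x) / q(y))\<close>, where \<open>q\<close> is the
  output law of a uniform input and \<open>y\<close> has law \<open>W(\<cdot>|x)\<close>, is the same for every letter \<open>x\<close>. Hence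
  it has mean \<open>C\<close> and variance \<open>\<nu>\<close> (in nats), and its sum along \<open>N\<close> channel uses has the
  \<open>N\<close>-th power of one moment generating function \<open>exp (s C + \<kappa> s)\<close> for every input word, with
  \<open>\<kappa> s\<close> asymptotic to \<open>\<nu> s\<^sup>2 / 2\<close>.

  Achievability: draw the codeword of block \<open>k\<close> at random for every prefix of \<open>k\<close> messages, and
  decode \<open>G\<^sub>k\<close> by maximum likelihood over all message prefixes. If the first wrong message has
  index \<open>j \<le> k\<close>, then \<open>l = k + T - j \<ge> T\<close> blocks carry independent codewords and at most \<open>M\<^sup>l\<close>
  prefixes compete; bounding \<open>min(1, u) \<le> u\<^sup>s\<close> makes the probability of this event at most
  \<open>r\<^sup>l\<close>, where \<open>r = M\<^sup>s E[exp (- s i)]\<^sup>n\<close>. The geometric sum is of order \<open>r\<^sup>T\<close>, and a union bound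
  over the messages costs only the factor \<open>S = exp o(n\<^sup>1\<^sup>-\<^sup>2\<^sup>t)\<close>.

  Converse: tilt the channel in all blocks so that its capacity falls just below the rate. As
  \<open>S\<close> exceeds \<open>n\<^sup>t\<close> in order, the \<open>T - 1\<close> extra blocks do not help, and the decoders cannot all
  succeed, even if a genie reveals the past messages to each of them. So some decoder \<open>k\<close> fails
  with probability at least of order \<open>1 / S\<close>. Given the past messages, its output depends on the
  blocks \<open>k, \<dots>, k + T - 1\<close> only, so returning to the true channel costs the likelihood ratio of
  \<open>T n\<close> channel uses.
\<close>

subsection \<open>Expectations over finitely supported distributions\<close>

lemma expectation_bind_finite:
  fixes f :: "'b \<Rightarrow> real"
  assumes "finite (set_pmf p)" "\<And>x. x \<in> set_pmf p \<Longrightarrow> finite (set_pmf (k x))"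
  shows "measure_pmf.expectation (bind_pmf p k) f =
         measure_pmf.expectation p (\<lambda>x. measure_pmf.expectation (k x) f)"
  using assms by (simp add: pmf_expectation_bind[of "set_pmf p" k p f] integral_measure_pmf[of "set_pmf p"])

lemma expectation_mono_finite:
  fixes f g :: "'b \<Rightarrow> real"
  assumes "finite (set_pmf p)" "\<And>x. x \<in> set_pmf p \<Longrightarrow> f x \<le> g x"
  shows "measure_pmf.expectation p f \<le> measure_pmf.expectation p g"
  using assms by (subst (1 2) integral_measure_pmf[of "set_pmf p"]) (auto intro!: sum_mono mult_left_mono)

lemma expectation_cong_pmf:
  fixes f g :: "'b \<Rightarrow> real"
  assumes "\<And>x. x \<in> set_pmf p \<Longrightarrow> f x = g x"
  shows "measure_pmf.expectation p f = measure_pmf.expectation p g"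
  using assms by (intro integral_cong_AE) (auto simp: AE_measure_pmf_iff)

lemma expectation_add_finite:
  fixes f g :: "'b \<Rightarrow> real"
  assumes "finite (set_pmf p)"
  shows "measure_pmf.expectation p (\<lambda>x. f x + g x) =
         measure_pmf.expectation p f + measure_pmf.expectation p g"
  using assms by (intro Bochner_Integration.integral_add integrable_measure_pmf_finite)

lemma expectation_sum_finite:
  fixes f :: "'a \<Rightarrow> 'b \<Rightarrow> real"
  assumes "finite (set_pmf p)"
  shows "measure_pmf.expectation p (\<lambda>x. \<Sum>i\<in>I. f i x) = (\<Sum>i\<in>I. measure_pmf.expectation p (f i))"
  using assms by (intro Bochner_Integration.integral_sum integrable_measure_pmf_finite)

lemma expectation_swap_finite:
  fixes f :: "'a \<Rightarrow> 'b \<Rightarrow> real"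
  assumes "finite (set_pmf p)" "finite (set_pmf q)"
  shows "measure_pmf.expectation p (\<lambda>x. measure_pmf.expectation q (f x)) =
         measure_pmf.expectation q (\<lambda>y. measure_pmf.expectation p (\<lambda>x. f x y))"
proof -
  have "measure_pmf.expectation p (\<lambda>x. measure_pmf.expectation q (f x)) =
        (\<Sum>x\<in>set_pmf p. \<Sum>y\<in>set_pmf q. pmf p x * (pmf q y * f x y))"
    using assms by (simp add: integral_measure_pmf[of "set_pmf p"] integral_measure_pmf[of "set_pmf q"]
        sum_distrib_left)
  also have "\<dots> = (\<Sum>y\<in>set_pmf q. \<Sum>x\<in>set_pmf p. pmf q y * (pmf p x * f x y))"
    by (subst sum.swap) (simp add: mult_ac)
  also have "\<dots> = measure_pmf.expectation q (\<lambda>y. measure_pmf.expectation p (\<lambda>x. f x y))"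
    using assms by (simp add: integral_measure_pmf[of "set_pmf p"] integral_measure_pmf[of "set_pmf q"]
        sum_distrib_left)
  finally show ?thesis .
qed

text \<open>The averaging argument: it later picks a favourable past for a decoder and a good code
  from a random ensemble.\<close>

lemma expectation_le_imp_exists:
  fixes f :: "'a \<Rightarrow> real"
  assumes "finite (set_pmf p)" "measure_pmf.expectation p f \<le> c"
  shows "\<exists>x\<in>set_pmf p. f x \<le> c"
proof (rule ccontr)
  assume "\<not> ?thesis"
  hence *: "\<And>x. x \<in> set_pmf p \<Longrightarrow> c < f x" by force
  have "c < measure_pmf.expectation p f"
    using assms(1) * by (intro measure_pmf.expectation_greater integrable_measure_pmf_finite)
      (auto simp: AE_measure_pmf_iff)
  thus False using assms by simp
qed

lemma prob_eq_expectation: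
  "measure_pmf.prob p A = measure_pmf.expectation p (indicator A)"
  by simp

lemma prob_bind_finite:
  assumes "finite (set_pmf p)" "\<And>x. x \<in> set_pmf p \<Longrightarrow> finite (set_pmf (k x))"
  shows "measure_pmf.prob (bind_pmf p k) A =
         measure_pmf.expectation p (\<lambda>x. measure_pmf.prob (k x) A)"
  unfolding prob_eq_expectation by (rule expectation_bind_finite[OF assms])

lemma prob_mono_pmf:
  assumes "\<And>x. x \<in> set_pmf p \<Longrightarrow> x \<in> A \<Longrightarrow> x \<in> B"
  shows "measure_pmf.prob p A \<le> measure_pmf.prob p B"
  using assms by (intro measure_pmf.finite_measure_mono_AE) (auto simp: AE_measure_pmf_iff)

text \<open>Markov's inequality in the form used throughout: \<open>f\<close> majorises the
  indicator of \<open>A\<close>, as an exponential or a likelihood ratio.\<close>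

lemma chernoff_pmf:
  assumes "finite (set_pmf p)" "\<And>x. x \<in> set_pmf p \<Longrightarrow> x \<in> A \<Longrightarrow> 1 \<le> f x" "\<And>x. 0 \<le> f x"
  shows "measure_pmf.prob p A \<le> measure_pmf.expectation p (f :: _ \<Rightarrow> real)"
  unfolding prob_eq_expectation
  by (rule expectation_mono_finite) (use assms in \<open>auto simp: indicator_def\<close>)

subsection \<open>Memoryless channels\<close>

lemma finite_set_dmc [simp]: "finite (set_pmf (dmc W xs :: 'y::finite list pmf))"
  by (induction xs) auto

lemma length_set_dmc: "ys \<in> set_pmf (dmc W xs) \<Longrightarrow> length ys = length xs"
  by (induction xs arbitrary: ys) auto

lemma dmc_append:
  "dmc W (xs @ xs') = bind_pmf (dmc W xs) (\<lambda>u. map_pmf (\<lambda>v. u @ v) (dmc W xs'))"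
  by (induction xs) (simp_all add: bind_return_pmf map_pmf_def bind_assoc_pmf bind_return_pmf')

lemma dmc_const: "dmc (\<lambda>_. q) xs = replicate_pmf (length xs) q"
  by (induction xs) simp_all

lemma pmf_map_Cons: "pmf (map_pmf ((#) x) p) (y # ys) = indicator {x} y * pmf p ys"
proof (cases "x = y")
  case True
  thus ?thesis using pmf_map_inj'[of "(#) x" p ys] by (simp add: inj_on_def)
next
  case False
  hence "y # ys \<notin> set_pmf (map_pmf ((#) x) p)" by auto
  thus ?thesis using False by (simp add: pmf_eq_0_set_pmf)
qed

lemma pmf_dmc_Cons [simp]: "pmf (dmc W (x # xs)) (y # ys) = pmf (W x) y * pmf (dmc W xs) ys"
proof -
  have "dmc W (x # xs) = bind_pmf (W x) (\<lambda>y. map_pmf ((#) y) (dmc W xs))"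
    by (simp add: map_pmf_def)
  hence "pmf (dmc W (x # xs)) (y # ys) =
      measure_pmf.expectation (W x) (\<lambda>z. indicator {y} z * pmf (dmc W xs) ys)"
    by (simp del: dmc.simps add: pmf_bind pmf_map_Cons indicator_def eq_commute)
  thus ?thesis by (simp add: measure_pmf_single)
qed

lemma pmf_dmc_append:
  "length us = length xs \<Longrightarrow>
   pmf (dmc W (xs @ xs')) (us @ vs) = pmf (dmc W xs) us * pmf (dmc W xs') vs"
  by (induction us xs rule: list_induct2) (simp_all del: dmc.simps(2))

lemma prob_dmc_append:
  fixes W :: "'x \<Rightarrow> 'y::finite pmf"
  shows "measure_pmf.prob (dmc W (xs @ xs')) A =
    measure_pmf.expectation (dmc W xs) (\<lambda>u. measure_pmf.prob (dmc W xs') {v. u @ v \<in> A})"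
  by (simp add: dmc_append prob_bind_finite vimage_def)

lemma prob_dmc_append_take:
  fixes W :: "'x \<Rightarrow> 'y::finite pmf"
  shows "measure_pmf.prob (dmc W (xs @ xs')) {ys. P (take (length xs) ys)} =
    measure_pmf.prob (dmc W xs) {ys. P ys}"
proof -
  have "measure_pmf.prob (dmc W (xs @ xs')) {ys. P (take (length xs) ys)} =
        measure_pmf.expectation (dmc W xs) (indicator {ys. P ys})"
    unfolding prob_dmc_append
    by (rule expectation_cong_pmf) (auto simp: length_set_dmc indicator_def)
  thus ?thesis by simp
qed

lemma prob_dmc_append_drop:
  fixes W :: "'x \<Rightarrow> 'y::finite pmf"
  shows "measure_pmf.prob (dmc W (xs @ xs')) {ys. P (drop (length xs) ys)} =
    measure_pmf.prob (dmc W xs') {ys. P ys}"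
proof -
  have "measure_pmf.prob (dmc W (xs @ xs')) {ys. P (drop (length xs) ys)} =
        measure_pmf.expectation (dmc W xs) (\<lambda>_. measure_pmf.prob (dmc W xs') {ys. P ys})"
    unfolding prob_dmc_append
    by (rule expectation_cong_pmf) (auto simp: length_set_dmc)
  thus ?thesis by simp
qed

lemma expectation_dmc_Cons:
  fixes W :: "'x \<Rightarrow> 'y::finite pmf" and f :: "'y list \<Rightarrow> real"
  shows "measure_pmf.expectation (dmc W (x # xs)) f =
    measure_pmf.expectation (W x) (\<lambda>y. measure_pmf.expectation (dmc W xs) (\<lambda>ys. f (y # ys)))"
  by (simp add: expectation_bind_finite)

lemma expectation_dmc_prod:
  fixes W :: "'x \<Rightarrow> 'y::finite pmf" and h :: "'x \<Rightarrow> 'y \<Rightarrow> real"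
  assumes "\<And>x. measure_pmf.expectation (W x) (h x) = c"
  shows "measure_pmf.expectation (dmc W xs) (\<lambda>ys. prod_list (map2 h xs ys)) = c ^ length xs"
  by (induction xs) (simp_all del: dmc.simps(2) add: expectation_dmc_Cons assms)

text \<open>Change of measure, letter by letter. An upper bound \<open>h\<close> on the likelihood
  ratio suffices, so outputs of probability zero call for no separate treatment.\<close>

lemma expectation_dmc_change:
  fixes U V :: "'x \<Rightarrow> 'y::finite pmf" and h :: "'x \<Rightarrow> 'y \<Rightarrow> real"
  assumes "\<And>x y. pmf (U x) y \<le> pmf (V x) y * h x y" "\<And>x y. 0 \<le> h x y" "\<And>ys. 0 \<le> f ys"
  shows "measure_pmf.expectation (dmc U xs) f \<le>
         measure_pmf.expectation (dmc V xs) (\<lambda>ys. prod_list (map2 h xs ys) * f ys)"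
  using assms(3)
proof (induction xs arbitrary: f)
  case (Cons x xs)
  have nn: "0 \<le> measure_pmf.expectation (dmc V xs) (\<lambda>ys. prod_list (map2 h xs ys) * f (y # ys))" for y
    using Cons.prems assms(2)
    by (intro integral_nonneg_AE AE_I2 mult_nonneg_nonneg prod_list_nonneg) (auto simp: set_zip)
  have "measure_pmf.expectation (dmc U (x # xs)) f \<le> measure_pmf.expectation (U x)
     (\<lambda>y. measure_pmf.expectation (dmc V xs) (\<lambda>ys. prod_list (map2 h xs ys) * f (y # ys)))"
    unfolding expectation_dmc_Cons
    by (intro expectation_mono_finite Cons.IH Cons.prems) auto
  also have "\<dots> = (\<Sum>y\<in>UNIV. pmf (U x) y * measure_pmf.expectation (dmc V xs) (\<lambda>ys. prod_list (map2 h xs ys) * f (y # ys)))"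
    by (simp add: integral_measure_pmf[of UNIV])
  also have "\<dots> \<le> (\<Sum>y\<in>UNIV. pmf (V x) y * h x y * measure_pmf.expectation (dmc V xs) (\<lambda>ys. prod_list (map2 h xs ys) * f (y # ys)))"
    by (intro sum_mono mult_right_mono assms nn)
  also have "\<dots> = measure_pmf.expectation (dmc V (x # xs)) (\<lambda>ys. prod_list (map2 h (x # xs) ys) * f ys)"
    unfolding expectation_dmc_Cons by (simp add: integral_measure_pmf[of UNIV] mult.assoc)
  finally show ?case .
qed simp

subsection \<open>Output symmetric channels\<close>

text \<open>For an output symmetric channel this is the output law of every capacity-achieving input
  distribution, see \<open>mutual_info_eq_capacity_iff\<close>.\<close>

definition out_pmf :: "('x::finite \<Rightarrow> 'y::finite pmf) \<Rightarrow> 'y pmf" where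
  "out_pmf W = bind_pmf (pmf_of_set UNIV) W"

definition dens :: "('x::finite \<Rightarrow> 'y::finite pmf) \<Rightarrow> 'x \<Rightarrow> 'y \<Rightarrow> real" where
  "dens W x y = ln (pmf (W x) y / pmf (out_pmf W) y)"

text \<open>
  For an output symmetric channel the law of \<open>dens W x\<close> under \<open>W x\<close> does not depend on \<open>x\<close>, so
  the following quantities are taken at an arbitrary input letter.
\<close>

definition dens_mgf :: "('x::finite \<Rightarrow> 'y::finite pmf) \<Rightarrow> real \<Rightarrow> real" where
  "dens_mgf W s = measure_pmf.expectation (W undefined) (\<lambda>y. exp (s * dens W undefined y))"

definition dens_mean :: "('x::finite \<Rightarrow> 'y::finite pmf) \<Rightarrow> real" where
  "dens_mean W = measure_pmf.expectation (W undefined) (dens W undefined)"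

definition dens_var :: "('x::finite \<Rightarrow> 'y::finite pmf) \<Rightarrow> real" where
  "dens_var W = measure_pmf.expectation (W undefined) (\<lambda>y. (dens W undefined y - dens_mean W)\<^sup>2)"

lemma pmf_out_pmf:
  "pmf (out_pmf (W :: 'x::finite \<Rightarrow> 'y::finite pmf)) y = (\<Sum>x\<in>UNIV. pmf (W x) y) / CARD('x)"
  unfolding out_pmf_def by (subst pmf_bind_pmf_of_set) auto

lemma pmf_out_pmf_pos: "pmf (W x) y > 0 \<Longrightarrow> pmf (out_pmf W) y > 0"
  unfolding pmf_out_pmf by (auto intro!: divide_pos_pos sum_pos2[of UNIV x])

lemma pmf_eq_out_pmf_dens: "pmf (W x) y > 0 \<Longrightarrow> pmf (W x) y = pmf (out_pmf W) y * exp (dens W x y)"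
  using pmf_out_pmf_pos[of W x y] by (simp add: dens_def)

text \<open>When \<open>pmf (W x) y = 0\<close>, the value of \<open>dens W x y\<close> is
  \<open>ln 0 = 0\<close> and in general only an inequality survives; it is enough for a change of
  measure.\<close>

lemma pmf_le_out_pmf_dens: "pmf (W x) y \<le> pmf (out_pmf W) y * exp (dens W x y)"
  using pmf_eq_out_pmf_dens[of W x y] by (cases "pmf (W x) y > 0") (auto simp: less_le)

text \<open>On each subset of the partition, the column permutations make the output law constant
  and the row permutations carry the values of one row to those of another. So the pair of
  \<open>W(y|x)\<close> and \<open>q(y)\<close> has the same joint law for all inputs, and every
  function \<open>h\<close> of it has the same mean.\<close>

lemma symmetric_expectation_eq:
  fixes W :: "'x::finite \<Rightarrow> 'y::finite pmf" and h :: "real \<Rightarrow> real \<Rightarrow> real"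
  assumes "output_symmetric W"
  shows "measure_pmf.expectation (W x) (\<lambda>y. h (pmf (W x) y) (pmf (out_pmf W) y)) =
         measure_pmf.expectation (W x') (\<lambda>y. h (pmf (W x') y) (pmf (out_pmf W) y))"
proof -
  let ?q = "pmf (out_pmf W)"
  obtain P where "partition_on UNIV P \<and> (\<forall>B\<in>P.
      (\<forall>x x'. \<exists>\<pi>. \<pi> permutes B \<and> (\<forall>y\<in>B. pmf (W x') y = pmf (W x) (\<pi> y))) \<and>
      (\<forall>y\<in>B. \<forall>y'\<in>B. \<exists>\<pi>. \<pi> permutes UNIV \<and> (\<forall>x. pmf (W x) y' = pmf (W (\<pi> x)) y)))"
    using assms unfolding output_symmetric_def by (elim exE)
  hence P: "partition_on UNIV P"
    "\<And>B x x'. B \<in> P \<Longrightarrow> \<exists>\<pi>. \<pi> permutes B \<and> (\<forall>y\<in>B. pmf (W x') y = pmf (W x) (\<pi> y))"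
    "\<And>B y y'. B \<in> P \<Longrightarrow> y \<in> B \<Longrightarrow> y' \<in> B \<Longrightarrow>
       \<exists>\<pi>. \<pi> permutes UNIV \<and> (\<forall>x. pmf (W x) y' = pmf (W (\<pi> x)) y)"
    by simp_all
  have q_eq: "?q y = ?q y'" if y: "B \<in> P" "y \<in> B" "y' \<in> B" for B y y'
  proof -
    obtain \<pi> where \<pi>: "\<pi> permutes UNIV" "\<forall>x. pmf (W x) y' = pmf (W (\<pi> x)) y"
      using P(3)[OF y] by blast
    have "(\<Sum>x\<in>UNIV. pmf (W x) y) = (\<Sum>x\<in>UNIV. pmf (W x) y')"
      using sum.permute[OF \<pi>(1), of "\<lambda>x. pmf (W x) y"] \<pi>(2) by simp
    thus ?thesis by (simp add: pmf_out_pmf)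
  qed
  define g where "g x y = pmf (W x) y * h (pmf (W x) y) (?q y)" for x y
  have split: "(\<Sum>y\<in>UNIV. g x y) = (\<Sum>B\<in>P. \<Sum>y\<in>B. g x y)" for x
    using sum.Union_disjoint[of P "g x"] P(1) by (auto simp: partition_on_def disjoint_def)
  have "(\<Sum>y\<in>B. g x' y) = (\<Sum>y\<in>B. g x y)" if B: "B \<in> P" for B
  proof -
    obtain \<pi> where \<pi>: "\<pi> permutes B" "\<forall>y\<in>B. pmf (W x') y = pmf (W x) (\<pi> y)"
      using P(2)[OF B] by blast
    have "(\<Sum>y\<in>B. g x y) = (\<Sum>y\<in>B. g x (\<pi> y))"
      using sum.permute[OF \<pi>(1), of "g x"] by simp
    also have "\<dots> = (\<Sum>y\<in>B. g x' y)"
    proof (intro sum.cong refl)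
      fix y assume y: "y \<in> B"
      hence "?q (\<pi> y) = ?q y" using permutes_in_image[OF \<pi>(1), of y] by (intro q_eq[OF B]) auto
      thus "g x (\<pi> y) = g x' y" using \<pi>(2) y by (simp add: g_def)
    qed
    finally show ?thesis by simp
  qed
  hence "(\<Sum>y\<in>UNIV. g x y) = (\<Sum>y\<in>UNIV. g x' y)" unfolding split by simp
  thus ?thesis by (simp add: integral_measure_pmf[of UNIV] g_def)
qed

context
  fixes W :: "'x::finite \<Rightarrow> 'y::finite pmf"
  assumes sym: "output_symmetric W"
begin

lemma expectation_exp_dens:
  "measure_pmf.expectation (W x) (\<lambda>y. exp (s * dens W x y)) = dens_mgf W s"
  unfolding dens_mgf_def dens_def
  by (rule symmetric_expectation_eq[OF sym, where h = "\<lambda>u v. exp (s * ln (u / v))"])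

lemma expectation_dens: "measure_pmf.expectation (W x) (dens W x) = dens_mean W"
  unfolding dens_mean_def dens_def
  by (rule symmetric_expectation_eq[OF sym, where h = "\<lambda>u v. ln (u / v)"])

lemma expectation_dens_square:
  "measure_pmf.expectation (W x) (\<lambda>y. (dens W x y - dens_mean W)\<^sup>2) = dens_var W"
  unfolding dens_var_def dens_def
  by (rule symmetric_expectation_eq[OF sym, where h = "\<lambda>u v. (ln (u / v) - dens_mean W)\<^sup>2"])

end

text \<open>Subtracting \<open>pmf p y - pmf q y\<close> from each summand leaves the total
  unchanged, as both laws sum to 1. For \<open>p > 0\<close> the new summand is
  \<open>p * (u - 1 - ln u)\<close> with \<open>u = q / p\<close>, which is nonnegative and vanishes
  only at \<open>u = 1\<close>.\<close>

lemma gibbs_inequality: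
  fixes p q :: "'a::finite pmf"
  assumes "\<And>y. pmf q y = 0 \<Longrightarrow> pmf p y = 0"
  shows "0 \<le> (\<Sum>y\<in>UNIV. pmf p y * ln (pmf p y / pmf q y))"
    and "(\<Sum>y\<in>UNIV. pmf p y * ln (pmf p y / pmf q y)) = 0 \<Longrightarrow> p = q"
proof -
  let ?d = "\<lambda>y. pmf p y * ln (pmf p y / pmf q y) - (pmf p y - pmf q y)"
  have d: "0 \<le> ?d y \<and> (?d y = 0 \<longrightarrow> pmf p y = pmf q y)" for y
  proof (cases "pmf p y = 0")
    case False
    define u where "u = pmf q y / pmf p y"
    have pos: "0 < pmf p y" "0 < pmf q y" using False assms[of y] by (auto simp: less_le)
    hence u: "0 < u" by (simp add: u_def)
    have e: "?d y = pmf p y * (u - 1 - ln u)"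
      using pos by (simp add: u_def ln_div field_simps)
    have "ln u \<le> u - 1" using u by (rule ln_le_minus_one)
    moreover have "u = 1" if "ln u = u - 1" using ln_eq_minus_one[OF u that] .
    ultimately show ?thesis unfolding e using pos by (auto simp: u_def)
  qed simp
  have s1: "(\<Sum>y\<in>UNIV. pmf r y) = 1" for r :: "'a pmf" by (rule sum_pmf_eq_1) auto
  have eq: "(\<Sum>y\<in>UNIV. pmf p y * ln (pmf p y / pmf q y)) = (\<Sum>y\<in>UNIV. ?d y)"
    by (simp add: sum_subtractf s1)
  show "0 \<le> (\<Sum>y\<in>UNIV. pmf p y * ln (pmf p y / pmf q y))"
    unfolding eq by (rule sum_nonneg) (use d in blast)
  assume "(\<Sum>y\<in>UNIV. pmf p y * ln (pmf p y / pmf q y)) = 0"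
  hence "\<forall>y\<in>UNIV. ?d y = 0" unfolding eq by (subst (asm) sum_nonneg_eq_0_iff) (use d in auto)
  thus "p = q" using d by (intro pmf_eqI) blast
qed

section \<open>Capacity and dispersion of an output symmetric channel\<close>

context
  fixes W :: "'x::finite \<Rightarrow> 'y::finite pmf" and b :: real
  assumes sym: "output_symmetric W" and b: "b > 1"
begin

text \<open>\<open>I(P,W)\<close> is the mean divergence of the rows \<open>W(.|x)\<close> from the
  output law of the uniform input, minus the divergence of \<open>PW\<close> from it. By symmetry
  the first term is the constant \<open>dens_mean W\<close>, so maximising over \<open>P\<close>
  means minimising one divergence.\<close>

lemma mutual_info_eq:
  "mutual_info b W P = (dens_mean W - (\<Sum>y\<in>UNIV. pmf (bind_pmf P W) y *
     ln (pmf (bind_pmf P W) y / pmf (out_pmf W) y))) / ln b"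
proof -
  let ?r = "pmf (bind_pmf P W)" and ?q = "pmf (out_pmf W)"
  have r: "?r y = (\<Sum>x\<in>UNIV. pmf P x * pmf (W x) y)" for y
    by (simp add: pmf_bind integral_measure_pmf[of UNIV])
  have term_eq: "pmf P x * pmf (W x) y * info_density b W P x y =
      (pmf P x * (pmf (W x) y * dens W x y) - pmf P x * pmf (W x) y * ln (?r y / ?q y)) / ln b" for x y
  proof (cases "pmf P x * pmf (W x) y = 0")
    case False
    hence pos: "pmf (W x) y > 0" "pmf P x * pmf (W x) y > 0"
      by (auto simp: less_le)
    have "?r y > 0" unfolding r using pos(2) by (intro sum_pos2[of UNIV x]) auto
    moreover have "?q y > 0" using pmf_out_pmf_pos[of W x y] pos(1) by simp
    ultimately show ?thesis using pos(1)
      by (simp add: info_density_def dens_def log_def ln_div field_simps)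
  qed auto
  have "(\<Sum>y\<in>UNIV. pmf (W x) y * dens W x y) = dens_mean W" for x
    using expectation_dens[OF sym, of x] by (simp add: integral_measure_pmf[of UNIV])
  hence "(\<Sum>x\<in>UNIV. \<Sum>y\<in>UNIV. pmf P x * (pmf (W x) y * dens W x y)) = (\<Sum>x\<in>UNIV. pmf P x * dens_mean W)"
    by (simp flip: sum_distrib_left)
  also have "\<dots> = dens_mean W"
    by (simp add: sum_distrib_right[symmetric] sum_pmf_eq_1)
  finally have 1: "(\<Sum>x\<in>UNIV. \<Sum>y\<in>UNIV. pmf P x * (pmf (W x) y * dens W x y)) = dens_mean W" .
  have 2: "(\<Sum>x\<in>UNIV. \<Sum>y\<in>UNIV. pmf P x * pmf (W x) y * ln (?r y / ?q y)) =
      (\<Sum>y\<in>UNIV. ?r y * ln (?r y / ?q y))"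
    by (subst sum.swap) (simp add: r flip: sum_distrib_right)
  show ?thesis
    unfolding mutual_info_def term_eq sum_divide_distrib[symmetric] sum_subtractf 1 2 ..
qed

lemma bind_pmf_abs_cont: "pmf (out_pmf W) y = 0 \<Longrightarrow> pmf (bind_pmf P W) y = 0"
proof -
  assume "pmf (out_pmf W) y = 0"
  hence "pmf (W x) y = 0" for x
    using pmf_out_pmf_pos[of W x y] by (auto simp: less_le)
  thus ?thesis by (simp add: pmf_bind)
qed

lemma capacity_eq: "capacity b W = dens_mean W / ln b"
proof -
  have le: "mutual_info b W P \<le> dens_mean W / ln b" for P
    unfolding mutual_info_eq using b gibbs_inequality(1)[of "out_pmf W" "bind_pmf P W", OF bind_pmf_abs_cont]
    by (intro divide_right_mono) auto
  have eq: "mutual_info b W (pmf_of_set UNIV) = dens_mean W / ln b"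
    unfolding mutual_info_eq out_pmf_def[symmetric]
    by (simp add: divide_self_if if_distrib cong: if_cong)
  show ?thesis unfolding capacity_def
    by (rule cSup_eq_maximum) (use le eq rangeI[of "mutual_info b W" "pmf_of_set UNIV"] in auto)
qed

lemma mutual_info_eq_capacity_iff: "mutual_info b W P = capacity b W \<longleftrightarrow> bind_pmf P W = out_pmf W"
proof
  assume "mutual_info b W P = capacity b W"
  thus "bind_pmf P W = out_pmf W" unfolding mutual_info_eq capacity_eq
    using b by (intro gibbs_inequality(2) bind_pmf_abs_cont) auto
next
  assume "bind_pmf P W = out_pmf W"
  thus "mutual_info b W P = capacity b W" unfolding mutual_info_eq capacity_eq
    by (simp add: divide_self_if if_distrib cong: if_cong)
qed

text \<open>All maximisers \<open>P\<close> share one output law, so their information densities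
  agree, and by symmetry each letter contributes the same variance: the minimum is over a
  constant.\<close>

lemma dispersion_eq: "dispersion b W = dens_var W / (ln b)\<^sup>2"
proof -
  have "cond_info_variance b W P = dens_var W / (ln b)\<^sup>2" if "bind_pmf P W = out_pmf W" for P
  proof -
    have i: "info_density b W P x = (\<lambda>y. dens W x y / ln b)" for x
      by (simp add: fun_eq_iff info_density_def dens_def log_def that)
    have "measure_pmf.expectation (W x) (info_density b W P x) = dens_mean W / ln b" for x
      using expectation_dens[OF sym, of x] by (simp add: i)
    hence "measure_pmf.variance (W x) (info_density b W P x) =
        measure_pmf.expectation (W x) (\<lambda>y. (dens W x y / ln b - dens_mean W / ln b)\<^sup>2)" for x
      by (simp only: i)
    moreover have "(dens W x y / ln b - dens_mean W / ln b)\<^sup>2 = (dens W x y - dens_mean W)\<^sup>2 / (ln b)\<^sup>2" for x y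
      by (simp add: power_divide flip: diff_divide_distrib)
    ultimately have "measure_pmf.variance (W x) (info_density b W P x) = dens_var W / (ln b)\<^sup>2" for x
      using expectation_dens_square[OF sym, of x] by simp
    thus ?thesis by (simp add: cond_info_variance_def)
  qed
  moreover have "bind_pmf (pmf_of_set UNIV) W = out_pmf W" by (simp add: out_pmf_def)
  ultimately show ?thesis unfolding dispersion_def mutual_info_eq_capacity_iff
    by (intro cInf_eq_minimum image_eqI[of _ _ "pmf_of_set UNIV"]) auto
qed

end

text \<open>A vanishing mean is a vanishing divergence of \<open>W undefined\<close> from the output
  law; then the density is identically zero and has no variance. Positivity makes the message sets
  grow with the block length.\<close>

lemma dens_mean_pos:
  assumes "dens_var W > 0"
  shows "dens_mean W > 0"
proof (rule ccontr)
  have ac: "pmf (out_pmf W) y = 0 \<Longrightarrow> pmf (W undefined) y = 0" for y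
    using pmf_out_pmf_pos[of W undefined y] by (auto simp: less_le)
  have m: "dens_mean W = (\<Sum>y\<in>UNIV. pmf (W undefined) y * ln (pmf (W undefined) y / pmf (out_pmf W) y))"
    by (simp add: dens_mean_def dens_def integral_measure_pmf[of UNIV])
  assume "\<not> ?thesis"
  hence z: "dens_mean W = 0" using gibbs_inequality(1)[of "out_pmf W" "W undefined", OF ac] m by simp
  hence "W undefined = out_pmf W" using gibbs_inequality(2)[of "out_pmf W" "W undefined", OF ac] m by simp
  hence "dens W undefined y = 0" for y by (simp add: dens_def divide_self_if)
  hence "dens_var W = 0" using z by (simp add: dens_var_def)
  thus False using assms by simp
qed

section \<open>Moment and cumulant generating functions of the information density\<close>

lemma dens_mgf_ge: "exp (s * dens_mean W) \<le> dens_mgf W s"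
proof -
  \<comment> \<open>Jensen's inequality, through the tangent \<open>1 + u\<close> of
    \<open>exp u\<close> at the mean.\<close>
  have "exp (s * dens_mean W) * measure_pmf.expectation (W undefined) (\<lambda>y. 1 + s * (dens W undefined y - dens_mean W))
     \<le> exp (s * dens_mean W) * measure_pmf.expectation (W undefined) (\<lambda>y. exp (s * (dens W undefined y - dens_mean W)))"
    by (intro mult_left_mono expectation_mono_finite exp_ge_add_one_self) auto
  also have "measure_pmf.expectation (W undefined) (\<lambda>y. 1 + s * (dens W undefined y - dens_mean W)) = 1"
    by (simp add: integrable_measure_pmf_finite dens_mean_def)
  also have "exp (s * dens_mean W) * measure_pmf.expectation (W undefined) (\<lambda>y. exp (s * (dens W undefined y - dens_mean W)))
     = dens_mgf W s"
    by (simp add: dens_mgf_def integral_measure_pmf[of UNIV] sum_distrib_left mult.left_commute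
        right_diff_distrib flip: exp_add)
  finally show ?thesis by simp
qed

lemma dens_mgf_pos: "dens_mgf W s > 0"
  using dens_mgf_ge[of s W] exp_gt_zero[of "s * dens_mean W"] by linarith

text \<open>The cumulant generating function of the density minus its mean, called \<kappa> in the
  overview; it starts at second order in \<open>s\<close>.\<close>

definition dens_cgf :: "('x::finite \<Rightarrow> 'y::finite pmf) \<Rightarrow> real \<Rightarrow> real" where
  "dens_cgf W s = ln (dens_mgf W s) - s * dens_mean W"

lemma dens_mgf_eq_exp: "dens_mgf W s = exp (s * dens_mean W + dens_cgf W s)"
  using dens_mgf_pos[of W s] by (simp add: dens_cgf_def)

lemma dens_cgf_nonneg: "0 \<le> dens_cgf W s"
  using dens_mgf_ge[of s W] dens_mgf_pos[of W s] by (simp add: dens_cgf_def ln_ge_iff)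

lemma exp_quadratic_limit: "((\<lambda>s. (exp (s * x) - 1 - s * x) / s\<^sup>2) \<longlongrightarrow> x\<^sup>2 / 2) (at (0::real))"
proof (cases "x = 0")
  case False
  thus ?thesis by (cases "x > 0"; real_asymp simp: power2_eq_square)
qed auto

text \<open>With the mean removed, the moment generating function \<open>f\<close> is
  \<open>1 + dens_var W * s^2 / 2\<close> to second order, and \<open>ln u\<close> behaves like
  \<open>u - 1\<close> near 1.\<close>

lemma dens_cgf_limit: "((\<lambda>s. dens_cgf W s / s\<^sup>2) \<longlongrightarrow> dens_var W / 2) (at 0)"
proof -
  define w where "w = pmf (W undefined)"
  define r where "r y = dens W undefined y - dens_mean W" for y
  define f where "f s = (\<Sum>y\<in>UNIV. w y * exp (s * r y))" for s
  have m0: "(\<Sum>y\<in>UNIV. w y * r y) = 0"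
    by (simp add: w_def r_def dens_mean_def integral_measure_pmf[of UNIV] right_diff_distrib sum_subtractf
        sum_distrib_right[symmetric] sum_pmf_eq_1)
  have w1: "(\<Sum>y\<in>UNIV. w y) = 1" by (simp add: w_def sum_pmf_eq_1)
  have f_eq: "f s = exp (dens_cgf W s)" for s
  proof -
    have "f s = dens_mgf W s * exp (- s * dens_mean W)"
      by (simp add: f_def w_def r_def dens_mgf_def integral_measure_pmf[of UNIV] sum_distrib_left
          sum_distrib_right algebra_simps exp_diff exp_minus divide_simps)
    thus ?thesis by (simp add: dens_mgf_eq_exp exp_add[symmetric])
  qed
  have f1: "(f s - 1) / s\<^sup>2 = (\<Sum>y\<in>UNIV. w y * ((exp (s * r y) - 1 - s * r y) / s\<^sup>2))" for s
  proof -
    have "(\<Sum>y\<in>UNIV. w y * (exp (s * r y) - 1 - s * r y)) = f s - 1 - s * (\<Sum>y\<in>UNIV. w y * r y)"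
      by (simp add: f_def right_diff_distrib sum_subtractf w1 sum_distrib_left mult_ac)
    thus ?thesis by (simp add: m0 flip: sum_divide_distrib)
  qed
  have lim1: "((\<lambda>s. (f s - 1) / s\<^sup>2) \<longlongrightarrow> dens_var W / 2) (at 0)"
  proof -
    have "((\<lambda>s. (f s - 1) / s\<^sup>2) \<longlongrightarrow> (\<Sum>y\<in>UNIV. w y * ((r y)\<^sup>2 / 2))) (at 0)"
      unfolding f1 by (intro tendsto_intros exp_quadratic_limit)
    thus ?thesis
      by (simp add: dens_var_def integral_measure_pmf[of UNIV] w_def r_def sum_divide_distrib)
  qed
  have f_cont: "(f \<longlongrightarrow> 1) (at 0)"
  proof -
    have "(f \<longlongrightarrow> (\<Sum>y\<in>UNIV. w y * exp (0 * r y))) (at 0)"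
      unfolding f_def by (intro tendsto_intros)
    thus ?thesis by (simp add: w1)
  qed
  \<comment> \<open>\<open>g\<close> fills the gap of \<open>ln u / (u - 1)\<close> at
    \<open>u = 1\<close>, so that \<open>g (f s) * (f s - 1) = ln (f s)\<close> holds even where
    \<open>f s = 1\<close>.\<close>
  define g where "g u = (if u = 1 then 1 else ln u / (u - 1))" for u :: real
  have g_lim: "(g \<longlongrightarrow> g 1) (at 1)"
  proof -
    have "((\<lambda>u. ln u / (u - 1)) \<longlongrightarrow> 1) (at (1::real))" by real_asymp
    moreover have "\<forall>\<^sub>F u in at 1. ln u / (u - 1) = g u" by (auto simp: eventually_at_filter g_def)
    ultimately have "(g \<longlongrightarrow> 1) (at 1)" by (rule Lim_transform_eventually)
    moreover have "g 1 = 1" by (simp add: g_def)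
    ultimately show ?thesis by (simp only:)
  qed
  hence "isCont g 1" by (simp add: isCont_def)
  hence "((\<lambda>s. g (f s)) \<longlongrightarrow> g 1) (at 0)" by (rule isCont_tendsto_compose) (rule f_cont)
  hence "((\<lambda>s. g (f s) * ((f s - 1) / s\<^sup>2)) \<longlongrightarrow> g 1 * (dens_var W / 2)) (at 0)"
    by (intro tendsto_mult lim1)
  moreover have "g (f s) * ((f s - 1) / s\<^sup>2) = dens_cgf W s / s\<^sup>2" for s
    by (simp add: g_def f_eq)
  moreover have "g 1 = 1" by (simp add: g_def)
  ultimately show ?thesis by (simp only: mult_1)
qed

section \<open>The tilted channel\<close>

definition tilt :: "('x::finite \<Rightarrow> 'y::finite pmf) \<Rightarrow> real \<Rightarrow> 'x \<Rightarrow> 'y pmf" where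
  "tilt W \<theta> x = embed_pmf (\<lambda>y. pmf (W x) y * exp (- \<theta> * dens W x y) / dens_mgf W (- \<theta>))"

text \<open>By symmetry one normalising constant serves all input letters. A positive \<theta>
  favours outputs of small density, which imitates a channel of smaller capacity.\<close>

lemma pmf_tilt:
  assumes "output_symmetric W"
  shows "pmf (tilt W \<theta> x) y = pmf (W x) y * exp (- \<theta> * dens W x y) / dens_mgf W (- \<theta>)"
  unfolding tilt_def
proof (rule pmf_embed_pmf)
  have nn: "0 \<le> pmf (W x) y * exp (- \<theta> * dens W x y) / dens_mgf W (- \<theta>)" for y
    using dens_mgf_pos[of W "- \<theta>"] by simp
  thus "\<And>y. 0 \<le> pmf (W x) y * exp (- \<theta> * dens W x y) / dens_mgf W (- \<theta>)" .
  have "(\<Sum>y\<in>UNIV. pmf (W x) y * exp (- \<theta> * dens W x y)) = dens_mgf W (- \<theta>)"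
    using expectation_exp_dens[OF assms, of x "- \<theta>"] by (simp add: integral_measure_pmf[of UNIV])
  thus "(\<integral>\<^sup>+ y. ennreal (pmf (W x) y * exp (- \<theta> * dens W x y) / dens_mgf W (- \<theta>)) \<partial>count_space UNIV) = 1"
    using nn dens_mgf_pos[of W "- \<theta>"]
    by (simp add: nn_integral_count_space_finite sum_ennreal sum_divide_distrib[symmetric])
qed

subsection \<open>The information density of words\<close>

definition word_dens :: "('x::finite \<Rightarrow> 'y::finite pmf) \<Rightarrow> 'x list \<Rightarrow> 'y list \<Rightarrow> real" where
  "word_dens W xs ys = sum_list (map2 (dens W) xs ys)"

lemma prod_list_exp_dens:
  "length ys = length xs \<Longrightarrow>
   prod_list (map2 (\<lambda>x y. exp (s * dens W x y) * c) xs ys) = exp (s * word_dens W xs ys) * c ^ length xs"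
  by (induction ys xs rule: list_induct2) (simp_all add: word_dens_def exp_add algebra_simps)

text \<open>Positivity of the word probability makes each letter probability positive, and there
  \<open>dens\<close> is the true log-likelihood ratio.\<close>

lemma pmf_dmc_eq_word_dens:
  "length ys = length xs \<Longrightarrow> pmf (dmc W xs) ys > 0 \<Longrightarrow>
   pmf (dmc W xs) ys = pmf (replicate_pmf (length xs) (out_pmf W)) ys * exp (word_dens W xs ys)"
proof (induction ys xs rule: list_induct2)
  case (Cons y ys x xs)
  have pos: "pmf (W x) y > 0" "pmf (dmc W xs) ys > 0"
    using Cons.prems by (auto simp: zero_less_mult_iff simp del: dmc.simps)
  show ?case
    using Cons.IH[OF pos(2)] pmf_eq_out_pmf_dens[of W x y] pos(1) pmf_dmc_Cons[of "\<lambda>_. out_pmf W" x xs y ys]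
    by (simp add: word_dens_def exp_add dmc_const del: dmc.simps(2) replicate_pmf.simps(2))
qed (simp add: word_dens_def)

context
  fixes W :: "'x::finite \<Rightarrow> 'y::finite pmf"
  assumes sym: "output_symmetric W"
begin

lemma expectation_exp_word_dens:
  "measure_pmf.expectation (dmc W xs) (\<lambda>ys. exp (s * word_dens W xs ys)) = dens_mgf W s ^ length xs"
proof -
  have "measure_pmf.expectation (dmc W xs) (\<lambda>ys. exp (s * word_dens W xs ys)) =
     measure_pmf.expectation (dmc W xs) (\<lambda>ys. prod_list (map2 (\<lambda>x y. exp (s * dens W x y)) xs ys))"
    using prod_list_exp_dens[where c = 1 and W = W and s = s]
    by (intro expectation_cong_pmf) (simp add: length_set_dmc)
  also have "\<dots> = dens_mgf W s ^ length xs"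
    by (intro expectation_dmc_prod expectation_exp_dens sym)
  finally show ?thesis .
qed

lemma expectation_tilt_exp_dens:
  "measure_pmf.expectation (tilt W \<theta> x) (\<lambda>y. exp (s * dens W x y)) = dens_mgf W (s - \<theta>) / dens_mgf W (- \<theta>)"
proof -
  have "pmf (tilt W \<theta> x) y * exp (s * dens W x y) =
      pmf (W x) y * exp ((s - \<theta>) * dens W x y) / dens_mgf W (- \<theta>)" for y
    by (simp add: pmf_tilt[OF sym] left_diff_distrib exp_diff exp_minus field_simps)
  thus ?thesis
    using expectation_exp_dens[OF sym, of x "s - \<theta>"]
    by (simp add: integral_measure_pmf[of UNIV] flip: sum_divide_distrib)
qed

text \<open>Tilting shifts the argument of the cumulant generating function by
  \<open>- \<theta>\<close>; the linear parts combine to \<open>s * dens_mean W\<close>.\<close>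

lemma expectation_tilt_exp_word_dens:
  "measure_pmf.expectation (dmc (tilt W \<theta>) xs) (\<lambda>ys. exp (s * word_dens W xs ys)) =
   exp (length xs * (s * dens_mean W + dens_cgf W (s - \<theta>) - dens_cgf W (- \<theta>)))"
proof -
  have "measure_pmf.expectation (dmc (tilt W \<theta>) xs) (\<lambda>ys. exp (s * word_dens W xs ys)) =
     measure_pmf.expectation (dmc (tilt W \<theta>) xs) (\<lambda>ys. prod_list (map2 (\<lambda>x y. exp (s * dens W x y)) xs ys))"
    using prod_list_exp_dens[where c = 1 and W = W and s = s]
    by (intro expectation_cong_pmf) (simp add: length_set_dmc)
  also have "\<dots> = (dens_mgf W (s - \<theta>) / dens_mgf W (- \<theta>)) ^ length xs"
    by (intro expectation_dmc_prod expectation_tilt_exp_dens)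
  also have "dens_mgf W (s - \<theta>) / dens_mgf W (- \<theta>) =
      exp (s * dens_mean W + dens_cgf W (s - \<theta>) - dens_cgf W (- \<theta>))"
    by (simp add: dens_mgf_eq_exp algebra_simps flip: exp_diff)
  finally show ?thesis by (simp add: exp_of_nat_mult)
qed

text \<open>Either the word density exceeds a threshold, which a Chernoff bound with parameter \<mu>
  controls under the tilted law, or it does not, and then the likelihood ratio of the tilted law to
  the product output law is bounded. Both bounds depend on the input word through its length only,
  so the outputs can be treated as independent of the messages.\<close>

lemma prob_tilt_le_output:
  assumes "0 \<le> \<mu>" "\<theta> \<le> 1"
  shows "measure_pmf.prob (dmc (tilt W \<theta>) xs) B \<le>
    exp (length xs * (\<mu> * \<xi> + dens_cgf W (\<mu> - \<theta>) - dens_cgf W (- \<theta>))) +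
    exp (length xs * (dens_mean W - \<xi> * (1 - \<theta>))) *
      measure_pmf.prob (replicate_pmf (length xs) (out_pmf W)) B"
proof -
  define N where "N = real (length xs)"
  \<comment> \<open>For small \<theta> the tilted word density is typically near
    \<open>N * (dens_mean W - \<theta> * dens_var W)\<close>; the threshold should lie above it, so
    \<xi> will be taken somewhat below \<open>\<theta> * dens_var W\<close>.\<close>
  define \<gamma> where "\<gamma> = N * (dens_mean W - \<xi>)"
  define F where "F = dens_mgf W (- \<theta>)"
  have F: "F > 0" by (simp add: F_def dens_mgf_pos)
  let ?U = "dmc (tilt W \<theta>) xs" and ?Q = "dmc (\<lambda>_. out_pmf W) xs"
  let ?A = "{ys. word_dens W xs ys \<le> \<gamma>}"
  have "measure_pmf.prob ?U B \<le> measure_pmf.prob ?U (- ?A \<union> (B \<inter> ?A))"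
    by (intro prob_mono_pmf) auto
  also have "\<dots> \<le> measure_pmf.prob ?U (- ?A) + measure_pmf.prob ?U (B \<inter> ?A)"
    by (intro measure_Un_le) auto
  also have "measure_pmf.prob ?U (- ?A) \<le>
      measure_pmf.expectation ?U (\<lambda>ys. exp (- \<mu> * \<gamma>) * exp (\<mu> * word_dens W xs ys))"
    using assms(1) by (intro chernoff_pmf) (auto simp flip: exp_add intro: mult_left_mono)
  also have "\<dots> = exp (N * (\<mu> * \<xi> + dens_cgf W (\<mu> - \<theta>) - dens_cgf W (- \<theta>)))"
    unfolding integral_mult_right_zero expectation_tilt_exp_word_dens N_def[symmetric]
    by (simp add: \<gamma>_def algebra_simps flip: exp_add)
  also have "measure_pmf.prob ?U (B \<inter> ?A) \<le> measure_pmf.expectation ?Q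
      (\<lambda>ys. prod_list (map2 (\<lambda>x y. exp ((1 - \<theta>) * dens W x y) * (1 / F)) xs ys) * indicator (B \<inter> ?A) ys)"
    unfolding prob_eq_expectation
  proof (rule expectation_dmc_change)
    fix x y
    have "pmf (tilt W \<theta> x) y \<le> pmf (out_pmf W) y * exp (dens W x y) * exp (- \<theta> * dens W x y) / F"
      unfolding pmf_tilt[OF sym] F_def[symmetric]
      by (intro divide_right_mono mult_right_mono pmf_le_out_pmf_dens) (use F in auto)
    thus "pmf (tilt W \<theta> x) y \<le> pmf (out_pmf W) y * (exp ((1 - \<theta>) * dens W x y) * (1 / F))"
      by (simp add: left_diff_distrib exp_diff exp_minus field_simps)
  qed (use F in auto)
  also have "\<dots> = measure_pmf.expectation ?Q
      (\<lambda>ys. exp ((1 - \<theta>) * word_dens W xs ys) * (1 / F) ^ length xs * indicator (B \<inter> ?A) ys)"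
    by (intro expectation_cong_pmf) (simp only: prod_list_exp_dens[OF length_set_dmc])
  \<comment> \<open>As \<open>\<theta> \<le> 1\<close>, the ratio is nondecreasing in the word
    density, so its value at the threshold bounds it on \<open>?A\<close>.\<close>
  also have "\<dots> \<le> measure_pmf.expectation ?Q
      (\<lambda>ys. exp ((1 - \<theta>) * \<gamma>) * (1 / F) ^ length xs * indicator B ys)"
    using F assms(2)
    by (intro expectation_mono_finite) (auto simp: indicator_def intro!: mult_right_mono mult_left_mono)
  also have "\<dots> = exp ((1 - \<theta>) * \<gamma>) * (1 / F) ^ length xs *
      measure_pmf.prob (replicate_pmf (length xs) (out_pmf W)) B"
    by (simp add: dmc_const)
  also have "\<dots> \<le> exp (N * (dens_mean W - \<xi> * (1 - \<theta>))) *
      measure_pmf.prob (replicate_pmf (length xs) (out_pmf W)) B"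
  proof (rule mult_right_mono)
    have "1 / F = exp (\<theta> * dens_mean W - dens_cgf W (- \<theta>))"
      by (simp add: F_def dens_mgf_eq_exp exp_add exp_minus exp_diff field_simps)
    hence "(1 / F) ^ length xs = exp (N * (\<theta> * dens_mean W - dens_cgf W (- \<theta>)))"
      by (simp add: N_def exp_of_nat_mult)
    also have "exp ((1 - \<theta>) * \<gamma>) * \<dots> =
        exp (N * (dens_mean W - \<xi> * (1 - \<theta>)) - N * dens_cgf W (- \<theta>))"
      by (simp add: \<gamma>_def algebra_simps flip: exp_add)
    also have "\<dots> \<le> exp (N * (dens_mean W - \<xi> * (1 - \<theta>)))"
      using dens_cgf_nonneg[of W "- \<theta>"] by (simp add: N_def)
    finally show "exp ((1 - \<theta>) * \<gamma>) * (1 / F) ^ length xs \<le> exp (N * (dens_mean W - \<xi> * (1 - \<theta>)))" .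
  qed auto
  finally show ?thesis by (simp add: N_def)
qed

text \<open>The return to the true channel: where the log-likelihood ratio is at most
  \<open>a\<close> the price is \<open>exp a\<close>, and a Chernoff bound with parameter \<rho>
  controls its upper tail. For small \<theta> the tilted mean of the ratio is about
  \<open>length xs * \<theta>^2 * dens_var W / 2\<close>; over \<open>T * n\<close> channel uses
  this produces the exponent of the converse.\<close>

lemma prob_tilt_le_prob:
  assumes "0 \<le> \<rho>"
  shows "measure_pmf.prob (dmc (tilt W \<theta>) xs) B \<le> exp a * measure_pmf.prob (dmc W xs) B +
    exp (- \<rho> * a + length xs * (dens_cgf W (- (1 + \<rho>) * \<theta>) - (1 + \<rho>) * dens_cgf W (- \<theta>)))"
proof -
  define N where "N = real (length xs)"
  define F where "F = dens_mgf W (- \<theta>)"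
  have F: "F > 0" by (simp add: F_def dens_mgf_pos)
  let ?U = "dmc (tilt W \<theta>) xs"
  \<comment> \<open>The log-likelihood ratio of the tilted to the true channel.\<close>
  define L where "L ys = - \<theta> * word_dens W xs ys - N * ln F" for ys
  let ?A = "{ys. L ys \<le> a}"
  have lnF: "ln F = - \<theta> * dens_mean W + dens_cgf W (- \<theta>)"
    by (simp add: F_def dens_mgf_eq_exp)
  have "measure_pmf.prob ?U B \<le> measure_pmf.prob ?U ((B \<inter> ?A) \<union> - ?A)"
    by (intro prob_mono_pmf) auto
  also have "\<dots> \<le> measure_pmf.prob ?U (B \<inter> ?A) + measure_pmf.prob ?U (- ?A)"
    by (intro measure_Un_le) auto
  also have "measure_pmf.prob ?U (- ?A) \<le>
      measure_pmf.expectation ?U (\<lambda>ys. exp (- \<rho> * a - \<rho> * N * ln F) * exp (- (\<rho> * \<theta>) * word_dens W xs ys))"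
  proof (rule chernoff_pmf)
    fix ys assume "ys \<in> - ?A"
    hence "\<rho> * a \<le> \<rho> * L ys" using assms by (intro mult_left_mono) auto
    thus "1 \<le> exp (- \<rho> * a - \<rho> * N * ln F) * exp (- (\<rho> * \<theta>) * word_dens W xs ys)"
      by (simp add: L_def algebra_simps flip: exp_add)
  qed auto
  also have "\<dots> = exp (- \<rho> * a + N * (dens_cgf W (- (1 + \<rho>) * \<theta>) - (1 + \<rho>) * dens_cgf W (- \<theta>)))"
  proof -
    have "- (\<rho> * \<theta>) - \<theta> = - (1 + \<rho>) * \<theta>" by (simp add: algebra_simps)
    thus ?thesis
      unfolding integral_mult_right_zero expectation_tilt_exp_word_dens N_def[symmetric] lnF
      by (simp only:) (simp add: algebra_simps flip: exp_add)
  qed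
  also have "measure_pmf.prob ?U (B \<inter> ?A) \<le> measure_pmf.expectation (dmc W xs)
      (\<lambda>ys. prod_list (map2 (\<lambda>x y. exp (- \<theta> * dens W x y) * (1 / F)) xs ys) * indicator (B \<inter> ?A) ys)"
    unfolding prob_eq_expectation
    by (rule expectation_dmc_change) (use F in \<open>auto simp: pmf_tilt[OF sym] F_def\<close>)
  also have "\<dots> = measure_pmf.expectation (dmc W xs)
      (\<lambda>ys. exp (- \<theta> * word_dens W xs ys) * (1 / F) ^ length xs * indicator (B \<inter> ?A) ys)"
    by (intro expectation_cong_pmf) (simp only: prod_list_exp_dens[OF length_set_dmc])
  also have "\<dots> = measure_pmf.expectation (dmc W xs) (\<lambda>ys. exp (L ys) * indicator (B \<inter> ?A) ys)"
    using F by (simp add: L_def exp_diff N_def exp_of_nat_mult power_divide)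
  also have "\<dots> \<le> measure_pmf.expectation (dmc W xs) (\<lambda>ys. exp a * indicator B ys)"
    by (intro expectation_mono_finite) (auto simp: indicator_def)
  also have "\<dots> = exp a * measure_pmf.prob (dmc W xs) B"
    by simp
  finally show ?thesis by (simp add: N_def)
qed

end

subsection \<open>Streaming codes\<close>

definition msg_words :: "nat \<Rightarrow> nat \<Rightarrow> nat list set" where
  "msg_words M j = {g. length g = j \<and> set g \<subseteq> {1..M}}"

text \<open>The range is half-open: \<open>blocks \<phi> S 1 (S + T)\<close> is the full
  transmission, and \<open>blocks \<phi> S k (k + T)\<close> is the window from the block that first
  carries message \<open>k\<close> to the last one that decoder \<open>k\<close> sees.\<close>

definition blocks :: "(nat \<Rightarrow> nat list \<Rightarrow> 'x list) \<Rightarrow> nat \<Rightarrow> nat \<Rightarrow> nat \<Rightarrow> nat list \<Rightarrow> 'x list" where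
  "blocks \<phi> S i j g = concat (map (\<lambda>k. \<phi> k (take (min k S) g)) [i..<j])"

definition unif_msgs :: "nat \<Rightarrow> nat \<Rightarrow> nat list pmf" where
  "unif_msgs M S = replicate_pmf S (pmf_of_set {1..M})"

lemma finite_msg_words [simp]: "finite (msg_words M j)"
  using finite_lists_length_eq[of "{1..M}" j] by (simp add: msg_words_def conj_commute)

lemma set_unif_msgs: "1 \<le> M \<Longrightarrow> set_pmf (unif_msgs M S) = msg_words M S"
  by (auto simp: unif_msgs_def set_replicate_pmf msg_words_def lists_eq_set)

lemma finite_set_unif_msgs [simp]: "1 \<le> M \<Longrightarrow> finite (set_pmf (unif_msgs M S))"
  by (simp add: set_unif_msgs)

lemma blocks_append: "i \<le> j \<Longrightarrow> j \<le> l \<Longrightarrow> blocks \<phi> S i l g = blocks \<phi> S i j g @ blocks \<phi> S j l g"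
  using upt_add_eq_append[of i j "l - j"] by (simp add: blocks_def)

lemma blocks_cong:
  assumes "\<And>m. m < j \<Longrightarrow> take m g = take m g'"
  shows "blocks \<phi> S i j g = blocks \<phi> S i j g'"
proof -
  have "\<phi> k (take (min k S) g) = \<phi> k (take (min k S) g')" if "k \<in> set [i..<j]" for k
    using that assms[of "min k S"] by (auto simp: min_def)
  thus ?thesis unfolding blocks_def by (intro arg_cong[of _ _ concat] map_cong) auto
qed

lemma length_blocks:
  assumes "\<And>k g. k \<in> {1..S + T - 1} \<Longrightarrow> g \<in> msg_words M (min k S) \<Longrightarrow> length (\<phi> k g) = n"
    and "1 \<le> i" "j \<le> S + T" "g \<in> msg_words M S"
  shows "length (blocks \<phi> S i j g) = (j - i) * n"
proof -
  have "length (\<phi> k (take (min k S) g)) = n" if "k \<in> set [i..<j]" for k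
    using that assms(2-4) by (intro assms(1)) (auto simp: msg_words_def dest: in_set_takeD)
  hence "map (length \<circ> (\<lambda>k. \<phi> k (take (min k S) g))) [i..<j] = map (\<lambda>_. n) [i..<j]"
    by (intro map_cong) auto
  thus ?thesis by (simp add: blocks_def length_concat sum_list_triv map_replicate_const sum_list_replicate)
qed

lemma streaming_error_eq:
  fixes W :: "'x \<Rightarrow> 'y::finite pmf"
  assumes "1 \<le> M"
  shows "streaming_error W n M T S \<phi> \<psi> k = measure_pmf.expectation (unif_msgs M S)
    (\<lambda>g. measure_pmf.prob (dmc W (blocks \<phi> S 1 (S + T) g))
      {ys. \<psi> k (take ((k + T - 1) * n) ys) \<noteq> g ! (k - 1)})"
proof -
  have "streaming_joint W M T S \<phi> =
      bind_pmf (unif_msgs M S) (\<lambda>g. map_pmf (Pair g) (dmc W (blocks \<phi> S 1 (S + T) g)))"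
    by (simp add: streaming_joint_def blocks_def map_pmf_def unif_msgs_def)
  thus ?thesis
    unfolding streaming_error_def using assms by (simp add: prob_bind_finite vimage_def)
qed

text \<open>Decoder \<open>k\<close> sees the first \<open>k + T - 1\<close> blocks, so the later
  ones integrate out.\<close>

lemma streaming_error_window:
  fixes W :: "'x \<Rightarrow> 'y::finite pmf"
  assumes "1 \<le> M" "1 \<le> T" "k \<in> {1..S}"
    and "\<And>k g. k \<in> {1..S + T - 1} \<Longrightarrow> g \<in> msg_words M (min k S) \<Longrightarrow> length (\<phi> k g) = n"
  shows "streaming_error W n M T S \<phi> \<psi> k = measure_pmf.expectation (unif_msgs M S)
    (\<lambda>g. measure_pmf.prob (dmc W (blocks \<phi> S 1 (k + T) g)) {ys. \<psi> k ys \<noteq> g ! (k - 1)})"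
  unfolding streaming_error_eq[OF assms(1)]
proof (rule expectation_cong_pmf)
  fix g assume "g \<in> set_pmf (unif_msgs M S)"
  hence g: "g \<in> msg_words M S" using assms(1) by (simp add: set_unif_msgs)
  have "length (blocks \<phi> S 1 (k + T) g) = (k + T - 1) * n"
    by (rule length_blocks[OF assms(4)]) (use assms(3) g in auto)
  thus "measure_pmf.prob (dmc W (blocks \<phi> S 1 (S + T) g))
        {ys. \<psi> k (take ((k + T - 1) * n) ys) \<noteq> g ! (k - 1)} =
      measure_pmf.prob (dmc W (blocks \<phi> S 1 (k + T) g)) {ys. \<psi> k ys \<noteq> g ! (k - 1)}"
    using assms(3) blocks_append[of 1 "k + T" "S + T" \<phi> S g]
      prob_dmc_append_take[of W "blocks \<phi> S 1 (k + T) g" _ "\<lambda>ys. \<psi> k ys \<noteq> g ! (k - 1)"] by simp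
qed

text \<open>
  A genie who reveals \<open>G\<^sub>1, \<dots>, G\<^bsub>k-1\<^esub>\<close> makes the outputs before block \<open>k\<close> useless: given those
  messages, they can be replaced by the most favourable past.
\<close>

lemma genie_decoder:
  fixes W :: "'x \<Rightarrow> 'y::finite pmf"
  assumes "1 \<le> M" "1 \<le> T" "k \<in> {1..S}"
    and len: "\<And>k g. k \<in> {1..S + T - 1} \<Longrightarrow> g \<in> msg_words M (min k S) \<Longrightarrow> length (\<phi> k g) = n"
  shows "\<exists>u. measure_pmf.expectation (unif_msgs M S) (\<lambda>g. measure_pmf.prob (dmc W (blocks \<phi> S k (k + T) g))
      {v. \<psi> k (u (take (k - 1) g) @ v) \<noteq> g ! (k - 1)}) \<le> streaming_error W n M T S \<phi> \<psi> k"
proof -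
  let ?H = "unif_msgs M (k - 1)" and ?R = "unif_msgs M (S - (k - 1))"
  define e where "e g u = measure_pmf.prob (dmc W (blocks \<phi> S k (k + T) g)) {v. \<psi> k (u @ v) \<noteq> g ! (k - 1)}"
    for g u
  have split: "unif_msgs M S = bind_pmf ?H (\<lambda>h. map_pmf (\<lambda>r. h @ r) ?R)"
    using replicate_pmf_distrib[of "k - 1" "S - (k - 1)" "pmf_of_set {1..M}"] assms(3)
    by (simp add: map_pmf_def unif_msgs_def)
  have E_split: "measure_pmf.expectation (unif_msgs M S) f =
      measure_pmf.expectation ?H (\<lambda>h. measure_pmf.expectation ?R (\<lambda>r. f (h @ r)))" for f :: "_ \<Rightarrow> real"
    unfolding split using assms(1) by (subst expectation_bind_finite) auto
  \<comment> \<open>Causality: the blocks before \<open>k\<close> involve at most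
    \<open>k - 1\<close> messages, so the law of the past outputs does not depend on
    \<open>r\<close>. This is what allows the exchange of the two expectations below.\<close>
  have past: "blocks \<phi> S 1 k (h @ r) = blocks \<phi> S 1 k h" if "h \<in> set_pmf ?H" for h r
    using that assms(1) by (intro blocks_cong) (auto simp: set_unif_msgs msg_words_def)
  \<comment> \<open>For each revealed past \<open>h\<close>, some fixed past output does no worse,
    on average over the remaining messages, than the random one.\<close>
  have "\<exists>u. measure_pmf.expectation ?R (\<lambda>r. e (h @ r) u) \<le>
      measure_pmf.expectation (dmc W (blocks \<phi> S 1 k h)) (\<lambda>u. measure_pmf.expectation ?R (\<lambda>r. e (h @ r) u))" for h
    using expectation_le_imp_exists[of "dmc W (blocks \<phi> S 1 k h)"
      "\<lambda>u. measure_pmf.expectation ?R (\<lambda>r. e (h @ r) u)"] by auto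
  then obtain u where u: "\<And>h. measure_pmf.expectation ?R (\<lambda>r. e (h @ r) (u h)) \<le>
      measure_pmf.expectation (dmc W (blocks \<phi> S 1 k h)) (\<lambda>u. measure_pmf.expectation ?R (\<lambda>r. e (h @ r) u))"
    by metis
  have "measure_pmf.expectation (unif_msgs M S) (\<lambda>g. e g (u (take (k - 1) g))) =
      measure_pmf.expectation ?H (\<lambda>h. measure_pmf.expectation ?R (\<lambda>r. e (h @ r) (u h)))"
    unfolding E_split using assms(1)
    by (intro expectation_cong_pmf) (auto simp: set_unif_msgs msg_words_def)
  also have "\<dots> \<le> measure_pmf.expectation ?H (\<lambda>h.
      measure_pmf.expectation (dmc W (blocks \<phi> S 1 k h)) (\<lambda>u. measure_pmf.expectation ?R (\<lambda>r. e (h @ r) u)))"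
    using assms(1) u by (intro expectation_mono_finite) auto
  also have "\<dots> = measure_pmf.expectation ?H (\<lambda>h. measure_pmf.expectation ?R (\<lambda>r.
      measure_pmf.expectation (dmc W (blocks \<phi> S 1 k (h @ r))) (\<lambda>u. e (h @ r) u)))"
  proof (rule expectation_cong_pmf)
    fix h assume h: "h \<in> set_pmf ?H"
    show "measure_pmf.expectation (dmc W (blocks \<phi> S 1 k h)) (\<lambda>u. measure_pmf.expectation ?R (\<lambda>r. e (h @ r) u)) =
      measure_pmf.expectation ?R (\<lambda>r. measure_pmf.expectation (dmc W (blocks \<phi> S 1 k (h @ r))) (\<lambda>u. e (h @ r) u))"
      unfolding past[OF h] using assms(1) by (intro expectation_swap_finite) auto
  qed
  also have "\<dots> = measure_pmf.expectation (unif_msgs M S) (\<lambda>g.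
      measure_pmf.expectation (dmc W (blocks \<phi> S 1 k g)) (e g))"
    unfolding E_split ..
  also have "\<dots> = streaming_error W n M T S \<phi> \<psi> k"
  proof -
    have "streaming_error W n M T S \<phi> \<psi> k = measure_pmf.expectation (unif_msgs M S)
        (\<lambda>g. measure_pmf.prob (dmc W (blocks \<phi> S 1 (k + T) g)) {ys. \<psi> k ys \<noteq> g ! (k - 1)})"
      by (rule streaming_error_window[OF assms])
    moreover have "blocks \<phi> S 1 (k + T) g = blocks \<phi> S 1 k g @ blocks \<phi> S k (k + T) g" for g
      using assms(3) by (intro blocks_append) auto
    ultimately show ?thesis by (simp add: prob_dmc_append e_def[abs_def])
  qed
  finally show ?thesis unfolding e_def by blast
qed

section \<open>Finite-length converse\<close>

lemma successive_decoding_unique: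
  assumes "length g = S" "length g' = S"
    and "\<forall>k\<in>{1..S}. D k (take (k - 1) g) = g ! (k - 1)" "\<forall>k\<in>{1..S}. D k (take (k - 1) g') = g' ! (k - 1)"
  shows "g = g'"
proof -
  \<comment> \<open>Each decoder is given the earlier messages, which by induction agree in both
    lists, so it returns the same next message.\<close>
  have "i \<le> S \<Longrightarrow> take i g = take i g'" for i
  proof (induction i)
    case (Suc i)
    have "g ! i = g' ! i" using assms(3,4)[rule_format, of "Suc i"] Suc by simp
    thus ?case using Suc assms(1,2) by (simp add: take_Suc_conv_app_nth)
  qed simp
  from this[of S] show ?thesis using assms(1,2) by simp
qed

lemma pmf_unif_msgs_le: "1 \<le> M \<Longrightarrow> pmf (unif_msgs M S) g \<le> (1 / real M) ^ S"
proof (induction S arbitrary: g)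
  case (Suc S)
  show ?case
  proof (cases g)
    case Nil
    hence "g \<notin> set_pmf (unif_msgs M (Suc S))" by (simp add: set_replicate_pmf unif_msgs_def del: replicate_pmf.simps)
    hence "pmf (unif_msgs M (Suc S)) g = 0" by (simp add: pmf_eq_0_set_pmf)
    thus ?thesis by simp
  next
    case (Cons y ys)
    have "pmf (unif_msgs M (Suc S)) (y # ys) = pmf (pmf_of_set {1..M}) y * pmf (unif_msgs M S) ys"
      using pmf_dmc_Cons[of "\<lambda>_. pmf_of_set {1..M}" "()" "replicate S ()" y ys]
      by (simp only: dmc_const length_Cons length_replicate unif_msgs_def)
    also have "\<dots> \<le> 1 / real M * (1 / real M) ^ S"
      using Suc.prems by (intro mult_mono Suc.IH) (auto simp: indicator_def)
    finally show ?thesis using Cons by simp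
  qed
qed (simp add: unif_msgs_def indicator_def)

text \<open>With the decoders fixed, at most one message list satisfies all the equations, so this
  is the chance of guessing one list.\<close>

lemma prob_unif_msgs_decodable:
  assumes "1 \<le> M"
  shows "measure_pmf.prob (unif_msgs M S) {g. \<forall>k\<in>{1..S}. D k (take (k - 1) g) = g ! (k - 1)} \<le> (1 / real M) ^ S"
    (is "measure_pmf.prob ?R ?A \<le> _")
proof (cases "?A \<inter> set_pmf ?R = {}")
  case True
  hence "measure_pmf.prob ?R ?A = 0" by (simp add: measure_pmf_zero_iff Int_commute)
  thus ?thesis by simp
next
  case False
  then obtain g where g: "g \<in> ?A" "g \<in> set_pmf ?R" by blast
  have "measure_pmf.prob ?R ?A \<le> measure_pmf.prob ?R {g}"
  proof (rule prob_mono_pmf)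
    fix g' assume "g' \<in> set_pmf ?R" "g' \<in> ?A"
    thus "g' \<in> {g}" using g successive_decoding_unique[of g' S g D]
      by (auto simp: set_unif_msgs[OF assms] msg_words_def)
  qed
  thus ?thesis using pmf_unif_msgs_le[OF assms, of S g] by (simp add: measure_pmf_single)
qed

lemma prob_dmc_window:
  fixes W :: "'x \<Rightarrow> 'y::finite pmf"
  shows "measure_pmf.prob (dmc W (xs @ ws @ zs)) {ys. P (take (length ws) (drop (length xs) ys))} =
    measure_pmf.prob (dmc W ws) {v. P v}"
  using prob_dmc_append_drop[of W xs "ws @ zs" "\<lambda>ys. P (take (length ws) ys)"]
    prob_dmc_append_take[of W ws zs P] by simp

text \<open>The first term is the chance that the tilted word density is too large, the second the
  chance of decoding everything from outputs independent of the messages, the third a union bound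
  over the decoders after the return to the true channel. The parameters stay free until
  \<open>converse_rate_aux\<close>.\<close>

theorem streaming_converse:
  fixes W :: "'x::finite \<Rightarrow> 'y::finite pmf"
  assumes sym: "output_symmetric W" and code: "streaming_code W n M \<epsilon> T S \<phi> \<psi>"
    and "\<theta> \<le> 1" "0 \<le> \<mu>" "0 \<le> \<rho>"
  shows "1 \<le> exp (real ((S + T - 1) * n) * (\<mu> * \<xi> + dens_cgf W (\<mu> - \<theta>) - dens_cgf W (- \<theta>))) +
    exp (real ((S + T - 1) * n) * (dens_mean W - \<xi> * (1 - \<theta>))) * (1 / real M) ^ S +
    real S * (exp a * \<epsilon> + exp (- \<rho> * a + real (T * n) *
      (dens_cgf W (- (1 + \<rho>) * \<theta>) - (1 + \<rho>) * dens_cgf W (- \<theta>))))"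
proof -
  define c1 where "c1 = exp (real ((S + T - 1) * n) * (\<mu> * \<xi> + dens_cgf W (\<mu> - \<theta>) - dens_cgf W (- \<theta>)))"
  define c2 where "c2 = exp (real ((S + T - 1) * n) * (dens_mean W - \<xi> * (1 - \<theta>)))"
  define c3 where "c3 = exp (- \<rho> * a + real (T * n) *
      (dens_cgf W (- (1 + \<rho>) * \<theta>) - (1 + \<rho>) * dens_cgf W (- \<theta>)))"
  have M: "1 \<le> M" and T: "1 \<le> T" and S: "1 \<le> S"
    and len: "\<And>k g. k \<in> {1..S + T - 1} \<Longrightarrow> g \<in> msg_words M (min k S) \<Longrightarrow> length (\<phi> k g) = n"
    and err: "Max (streaming_error W n M T S \<phi> \<psi> ` {1..S}) \<le> \<epsilon>"
    using code by (auto simp: streaming_code_def msg_words_def)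
  have err: "streaming_error W n M T S \<phi> \<psi> k \<le> \<epsilon>" if "k \<in> {1..S}" for k
    using err that Max_ge[of "streaming_error W n M T S \<phi> \<psi> ` {1..S}" "streaming_error W n M T S \<phi> \<psi> k"]
    by force
  let ?U = "tilt W \<theta>" and ?R = "unif_msgs M S"
  let ?X = "blocks \<phi> S 1 (S + T)" and ?B = "\<lambda>k. blocks \<phi> S k (k + T)"
  have "\<forall>k\<in>{1..S}. \<exists>u. measure_pmf.expectation ?R (\<lambda>g. measure_pmf.prob (dmc W (?B k g))
      {v. \<psi> k (u (take (k - 1) g) @ v) \<noteq> g ! (k - 1)}) \<le> streaming_error W n M T S \<phi> \<psi> k"
    by (intro ballI genie_decoder[OF M T _ len])
  from bchoice[OF this] obtain u where u: "\<forall>k\<in>{1..S}. measure_pmf.expectation ?R (\<lambda>g. measure_pmf.prob (dmc W (?B k g))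
      {v. \<psi> k (u k (take (k - 1) g) @ v) \<noteq> g ! (k - 1)}) \<le> streaming_error W n M T S \<phi> \<psi> k"
    by (elim exE)
  define E where "E k g = {v. \<psi> k (u k (take (k - 1) g) @ v) \<noteq> g ! (k - 1)}" for k g
  \<comment> \<open>Decoder \<open>k\<close> with its genie: the past output is replaced by the
    fixed word \<open>u k h\<close>, and only the blocks \<open>k\<close> to
    \<open>k + T - 1\<close> of the actual output are read.\<close>
  define D where "D ys k h = \<psi> k (u k h @ take (T * n) (drop ((k - 1) * n) ys))" for ys k h
  define A where "A g = {ys. \<forall>k\<in>{1..S}. D ys k (take (k - 1) g) = g ! (k - 1)}" for g
  have split: "1 \<le> c1 + c2 * measure_pmf.prob (replicate_pmf ((S + T - 1) * n) (out_pmf W)) (A g) +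
      (\<Sum>k\<in>{1..S}. exp a * measure_pmf.prob (dmc W (?B k g)) (E k g) + c3)" if g: "g \<in> msg_words M S" for g
  proof -
    have lenX: "length (?X g) = (S + T - 1) * n"
      by (rule length_blocks[OF len]) (use g in auto)
    \<comment> \<open>The event involves a window of \<open>T\<close> blocks, so the likelihood
      ratio is paid over \<open>T * n\<close> channel uses and not over the whole
      transmission.\<close>
    have win: "measure_pmf.prob (dmc ?U (?X g)) {ys. D ys k (take (k - 1) g) \<noteq> g ! (k - 1)} =
        measure_pmf.prob (dmc ?U (?B k g)) (E k g)" if k: "k \<in> {1..S}" for k
    proof -
      have "?X g = blocks \<phi> S 1 k g @ ?B k g @ blocks \<phi> S (k + T) (S + T) g"
        using k by (simp flip: blocks_append)
      moreover have "length (blocks \<phi> S 1 k g) = (k - 1) * n"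
        by (rule length_blocks[OF len]) (use g k in auto)
      moreover have "length (?B k g) = (k + T - k) * n"
        by (rule length_blocks[OF len]) (use g k in auto)
      ultimately show ?thesis
        using prob_dmc_window[of ?U "blocks \<phi> S 1 k g" "?B k g" "blocks \<phi> S (k + T) (S + T) g"
          "\<lambda>v. v \<in> E k g"] by (simp add: E_def D_def)
    qed
    have "1 = measure_pmf.prob (dmc ?U (?X g)) (A g \<union> (\<Union>k\<in>{1..S}. {ys. D ys k (take (k - 1) g) \<noteq> g ! (k - 1)}))"
    proof -
      have "A g \<union> (\<Union>k\<in>{1..S}. {ys. D ys k (take (k - 1) g) \<noteq> g ! (k - 1)}) = UNIV"
        by (auto simp: A_def)
      thus ?thesis by (simp only: measure_pmf_UNIV)
    qed
    also have "\<dots> \<le> measure_pmf.prob (dmc ?U (?X g)) (A g) +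
        measure_pmf.prob (dmc ?U (?X g)) (\<Union>k\<in>{1..S}. {ys. D ys k (take (k - 1) g) \<noteq> g ! (k - 1)})"
      by (intro measure_Un_le) auto
    also have "measure_pmf.prob (dmc ?U (?X g)) (A g) \<le>
        c1 + c2 * measure_pmf.prob (replicate_pmf ((S + T - 1) * n) (out_pmf W)) (A g)"
      using prob_tilt_le_output[OF sym \<open>0 \<le> \<mu>\<close> \<open>\<theta> \<le> 1\<close>, of "?X g" "A g" \<xi>]
      unfolding lenX c1_def c2_def .
    also have "measure_pmf.prob (dmc ?U (?X g)) (\<Union>k\<in>{1..S}. {ys. D ys k (take (k - 1) g) \<noteq> g ! (k - 1)})
        \<le> (\<Sum>k\<in>{1..S}. measure_pmf.prob (dmc ?U (?X g)) {ys. D ys k (take (k - 1) g) \<noteq> g ! (k - 1)})"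
      by (rule measure_UNION_le) auto
    also have "\<dots> \<le> (\<Sum>k\<in>{1..S}. exp a * measure_pmf.prob (dmc W (?B k g)) (E k g) + c3)"
    proof (rule sum_mono)
      fix k assume k: "k \<in> {1..S}"
      have "length (?B k g) = (k + T - k) * n"
        by (rule length_blocks[OF len]) (use g k in auto)
      thus "measure_pmf.prob (dmc ?U (?X g)) {ys. D ys k (take (k - 1) g) \<noteq> g ! (k - 1)} \<le>
          exp a * measure_pmf.prob (dmc W (?B k g)) (E k g) + c3"
        unfolding win[OF k] c3_def
        using prob_tilt_le_prob[OF sym \<open>0 \<le> \<rho>\<close>, of \<theta> "?B k g" "E k g" a] by simp
    qed
    finally show ?thesis by simp
  qed
  have "1 = measure_pmf.expectation ?R (\<lambda>_. 1 :: real)" by simp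
  also have "\<dots> \<le> measure_pmf.expectation ?R (\<lambda>g. c1 + c2 * measure_pmf.prob (replicate_pmf ((S + T - 1) * n) (out_pmf W)) (A g) +
      (\<Sum>k\<in>{1..S}. exp a * measure_pmf.prob (dmc W (?B k g)) (E k g) + c3))"
    using split M by (intro expectation_mono_finite) (auto simp: set_unif_msgs)
  also have "\<dots> = c1 + c2 * measure_pmf.expectation ?R (\<lambda>g. measure_pmf.prob (replicate_pmf ((S + T - 1) * n) (out_pmf W)) (A g)) +
      (\<Sum>k\<in>{1..S}. exp a * measure_pmf.expectation ?R (\<lambda>g. measure_pmf.prob (dmc W (?B k g)) (E k g)) + c3)"
    using M by (simp add: expectation_add_finite expectation_sum_finite)
  also have "\<dots> \<le> c1 + c2 * (1 / real M) ^ S + (\<Sum>k\<in>{1..S}. exp a * \<epsilon> + c3)"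
  proof (intro add_mono mult_left_mono order.refl sum_mono)
    let ?Q = "replicate_pmf ((S + T - 1) * n) (out_pmf W)"
    have finQ: "finite (set_pmf ?Q)"
      using finite_set_dmc[of "\<lambda>_. out_pmf W" "replicate ((S + T - 1) * n) ()"] by (simp add: dmc_const)
    \<comment> \<open>Under \<open>?Q\<close> the outputs do not depend on \<open>g\<close>, so the
      messages can be averaged first, with the outputs fixed.\<close>
    have "measure_pmf.expectation ?R (\<lambda>g. measure_pmf.prob ?Q (A g)) =
        measure_pmf.expectation ?Q (\<lambda>ys. measure_pmf.expectation ?R (\<lambda>g. indicator (A g) ys))"
      unfolding prob_eq_expectation using M finQ by (intro expectation_swap_finite) auto
    also have "\<dots> = measure_pmf.expectation ?Q (\<lambda>ys. measure_pmf.prob ?R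
        {g. \<forall>k\<in>{1..S}. D ys k (take (k - 1) g) = g ! (k - 1)})"
    proof -
      have "(\<lambda>g. indicator (A g) ys) =
          (indicator {g. \<forall>k\<in>{1..S}. D ys k (take (k - 1) g) = g ! (k - 1)} :: _ \<Rightarrow> real)" for ys
        by (simp add: fun_eq_iff A_def indicator_def)
      thus ?thesis by (simp only: prob_eq_expectation)
    qed
    also have "\<dots> \<le> measure_pmf.expectation ?Q (\<lambda>ys. (1 / real M) ^ S)"
      using finQ by (intro expectation_mono_finite prob_unif_msgs_decodable M)
    finally show "measure_pmf.expectation ?R (\<lambda>g. measure_pmf.prob ?Q (A g)) \<le> (1 / real M) ^ S" by simp
    fix k assume k: "k \<in> {1..S}"
    show "measure_pmf.expectation ?R (\<lambda>g. measure_pmf.prob (dmc W (?B k g)) (E k g)) \<le> \<epsilon>"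
      using u[rule_format, OF k] err[OF k] unfolding E_def by linarith
  qed (auto simp: c2_def)
  also have "\<dots> = c1 + c2 * (1 / real M) ^ S + real S * (exp a * \<epsilon> + c3)" by simp
  finally show ?thesis unfolding c1_def c2_def c3_def .
qed

subsection \<open>Random tree codes\<close>

text \<open>Letters of a random table at distinct indices are independent; this is how independence
  of codewords enters below.\<close>

lemma map_Pi_pmf_distinct:
  fixes p :: "'b pmf"
  assumes "finite A" "distinct is" "set is \<subseteq> A"
  shows "map_pmf (\<lambda>f. map f is) (Pi_pmf A d (\<lambda>_. p)) = replicate_pmf (length is) p"
  using assms
proof (induction "is" arbitrary: A)
  case (Cons i "is")
  have A: "A = insert i (A - {i})" using Cons.prems by auto
  have "map_pmf (\<lambda>f. map f (i # is)) (Pi_pmf A d (\<lambda>_. p)) =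
      bind_pmf p (\<lambda>y. map_pmf (\<lambda>f. map (f(i := y)) (i # is)) (Pi_pmf (A - {i}) d (\<lambda>_. p)))"
    by (subst A, subst Pi_pmf_insert')
      (use Cons.prems in \<open>auto simp: map_bind_pmf map_pmf_def[symmetric] map_pmf_comp o_def\<close>)
  also have "map (f(i := y)) (i # is) = y # map f is" for f and y :: 'b
    using Cons.prems by auto
  hence "(\<lambda>y. map_pmf (\<lambda>f. map (f(i := y)) (i # is)) (Pi_pmf (A - {i}) d (\<lambda>_. p))) =
      (\<lambda>y. map_pmf (\<lambda>xs. y # xs) (map_pmf (\<lambda>f. map f is) (Pi_pmf (A - {i}) d (\<lambda>_. p))))"
    by (simp only: map_pmf_comp)
  also have "map_pmf (\<lambda>f. map f is) (Pi_pmf (A - {i}) d (\<lambda>_. p)) = replicate_pmf (length is) p"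
    using Cons.prems by (intro Cons.IH) auto
  finally show ?case by (simp add: map_pmf_def)
qed simp

lemma bind_replicate_pmf_dmc: "bind_pmf (replicate_pmf N p) (dmc W) = replicate_pmf N (bind_pmf p W)"
proof (induction N)
  case (Suc N)
  have "bind_pmf (replicate_pmf (Suc N) p) (dmc W) =
      bind_pmf p (\<lambda>x. bind_pmf (replicate_pmf N p) (\<lambda>xs. bind_pmf (W x) (\<lambda>y. map_pmf ((#) y) (dmc W xs))))"
    by (simp add: bind_assoc_pmf bind_return_pmf map_pmf_def)
  also have "\<dots> = bind_pmf p (\<lambda>x. bind_pmf (W x) (\<lambda>y. bind_pmf (replicate_pmf N p) (\<lambda>xs. map_pmf ((#) y) (dmc W xs))))"
    by (subst bind_commute_pmf) simp
  also have "\<dots> = bind_pmf (bind_pmf p W) (\<lambda>y. map_pmf ((#) y) (bind_pmf (replicate_pmf N p) (dmc W)))"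
    by (simp add: bind_assoc_pmf map_bind_pmf)
  finally show ?case by (simp add: Suc.IH map_pmf_def)
qed (simp add: bind_return_pmf)

lemma finite_set_replicate_pmf [simp]: "finite (set_pmf (replicate_pmf N (p :: 'a::finite pmf)))"
  using finite_set_dmc[of "\<lambda>_. p" "replicate N ()"] by (simp add: dmc_const)

lemma expectation_random_word_dmc:
  "measure_pmf.expectation (replicate_pmf N (pmf_of_set UNIV)) (\<lambda>xs. pmf (dmc W xs) ys) =
   pmf (replicate_pmf N (out_pmf (W :: 'x::finite \<Rightarrow> 'y::finite pmf))) ys"
  unfolding out_pmf_def bind_replicate_pmf_dmc[symmetric] by (simp add: pmf_bind)

text \<open>Markov's inequality for the likelihood ratio of a fresh random word: averaged over that
  word, the numerator becomes the product output law.\<close>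

lemma prob_random_word_le:
  fixes W :: "'x::finite \<Rightarrow> 'y::finite pmf"
  assumes "ys \<in> set_pmf (dmc W xs)"
  shows "measure_pmf.prob (replicate_pmf (length xs) (pmf_of_set UNIV)) {xs'. pmf (dmc W xs) ys \<le> pmf (dmc W xs') ys}
    \<le> exp (- word_dens W xs ys)"
proof -
  have pos: "pmf (dmc W xs) ys > 0" using assms by (rule pmf_positive)
  have "measure_pmf.prob (replicate_pmf (length xs) (pmf_of_set UNIV)) {xs'. pmf (dmc W xs) ys \<le> pmf (dmc W xs') ys}
     \<le> measure_pmf.expectation (replicate_pmf (length xs) (pmf_of_set UNIV)) (\<lambda>xs'. pmf (dmc W xs') ys / pmf (dmc W xs) ys)"
    using pos by (intro chernoff_pmf) auto
  also have "\<dots> = pmf (replicate_pmf (length xs) (out_pmf W)) ys / pmf (dmc W xs) ys"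
    by (simp add: expectation_random_word_dmc)
  also have "\<dots> = exp (- word_dens W xs ys)"
    using pmf_dmc_eq_word_dens[OF length_set_dmc[OF assms] pos] pos
    by (auto simp: exp_minus divide_simps zero_less_mult_iff)
  finally show ?thesis .
qed

lemma finite_set_Pi_pmf_finite [simp]:
  "finite A \<Longrightarrow> finite (set_pmf (Pi_pmf A d (\<lambda>_. p :: 'a::finite pmf)))"
  by (subst set_Pi_pmf) auto

text \<open>
  The indicator of a union of \<open>N\<close> events is at most \<open>hi + lo * N\<close> for any choice of \<open>hi = 1 - lo \<in> {0, 1}\<close>
  depending only on the transmitted word and the output; the bound is then linear in the
  competing words, so that only pairwise independence matters.
\<close>

lemma random_coding_union_bound:
  fixes W :: "'x::finite \<Rightarrow> 'y::finite pmf"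
  assumes sym: "output_symmetric W" and A: "finite A" "set is \<subseteq> A"
    and C: "finite C" "real (card C) \<le> L" "0 < L"
    and comp: "\<And>h. h \<in> C \<Longrightarrow> distinct (is @ js h) \<and> set (js h) \<subseteq> A \<and> length (js h) = length is"
    and dist: "distinct is" and s: "0 \<le> s" "s \<le> 1"
  shows "measure_pmf.expectation (Pi_pmf A d (\<lambda>_. pmf_of_set UNIV)) (\<lambda>f.
      measure_pmf.prob (dmc W (map f is)) {ys. \<exists>h\<in>C. pmf (dmc W (map f is)) ys \<le> pmf (dmc W (map f (js h))) ys})
    \<le> L powr s * dens_mgf W (- s) ^ length is"
proof -
  let ?F = "Pi_pmf A d (\<lambda>_. pmf_of_set UNIV) :: ('a \<Rightarrow> 'x) pmf"
  let ?N = "length is"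
  let ?X = "replicate_pmf ?N (pmf_of_set UNIV) :: 'x list pmf"
  \<comment> \<open>\<open>hi\<close> marks the outputs at which the union bound reaches 1 and says
    nothing; \<open>lo\<close> marks the others.\<close>
  define hi :: "'x list \<Rightarrow> 'y list \<Rightarrow> real" where "hi xs ys = (if 1 \<le> L * exp (- word_dens W xs ys) then 1 else 0)" for xs ys
  define lo where "lo xs ys = 1 - hi xs ys" for xs ys
  define I :: "'x list \<Rightarrow> 'x list \<Rightarrow> 'y list \<Rightarrow> real" where
    "I xs xs' ys = indicator {ys. pmf (dmc W xs) ys \<le> pmf (dmc W xs') ys} ys" for xs xs' ys
  have hl: "hi xs ys = 1 \<and> lo xs ys = 0 \<or> hi xs ys = 0 \<and> lo xs ys = 1" for xs ys
    by (simp add: hi_def lo_def)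
  have nonneg: "0 \<le> lo xs ys" "0 \<le> I xs xs' ys" for xs xs' ys
    by (simp_all add: lo_def hi_def I_def)
  have EF: "measure_pmf.expectation ?F (\<lambda>f. g (map f is)) = measure_pmf.expectation ?X g" for g :: "_ \<Rightarrow> real"
    using map_Pi_pmf_distinct[OF A(1) dist A(2), of d "pmf_of_set UNIV :: 'x pmf"]
    by (metis integral_map_pmf)
  \<comment> \<open>The indices of the two words are jointly distinct, so the words are independent
    and uniform.\<close>
  have EF2: "measure_pmf.expectation ?F (\<lambda>f. g (map f is) (map f (js h))) =
      measure_pmf.expectation ?X (\<lambda>xs. measure_pmf.expectation ?X (g xs))"
    if h: "h \<in> C" for g :: "_ \<Rightarrow> _ \<Rightarrow> real" and h
  proof -
    have len: "length (is @ js h) = ?N + ?N" using comp[OF h] by simp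
    have "measure_pmf.expectation ?F (\<lambda>f. g (map f is) (map f (js h))) =
        measure_pmf.expectation (map_pmf (\<lambda>f. map f (is @ js h)) ?F) (\<lambda>zs. g (take ?N zs) (drop ?N zs))"
      by simp
    also have "map_pmf (\<lambda>f. map f (is @ js h)) ?F =
        bind_pmf ?X (\<lambda>xs. map_pmf (\<lambda>xs'. xs @ xs') ?X)"
      using map_Pi_pmf_distinct[OF A(1), of "is @ js h" d "pmf_of_set UNIV :: 'x pmf"] comp[OF h] A(2)
      unfolding len replicate_pmf_distrib by (simp add: map_pmf_def)
    also have "measure_pmf.expectation (bind_pmf ?X (\<lambda>xs. map_pmf (\<lambda>xs'. xs @ xs') ?X)) (\<lambda>zs. g (take ?N zs) (drop ?N zs)) =
        measure_pmf.expectation ?X (\<lambda>xs. measure_pmf.expectation ?X (\<lambda>xs'. g (take ?N (xs @ xs')) (drop ?N (xs @ xs'))))"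
      by (subst expectation_bind_finite) auto
    also have "\<dots> = measure_pmf.expectation ?X (\<lambda>xs. measure_pmf.expectation ?X (g xs))"
      by (intro expectation_cong_pmf) (simp add: set_replicate_pmf)
    finally show ?thesis .
  qed
  have "measure_pmf.expectation ?F (\<lambda>f.
      measure_pmf.prob (dmc W (map f is)) {ys. \<exists>h\<in>C. pmf (dmc W (map f is)) ys \<le> pmf (dmc W (map f (js h))) ys})
    \<le> measure_pmf.expectation ?F (\<lambda>f. measure_pmf.expectation (dmc W (map f is)) (\<lambda>ys.
        hi (map f is) ys + (\<Sum>h\<in>C. lo (map f is) ys * I (map f is) (map f (js h)) ys)))"
    unfolding prob_eq_expectation
  proof (intro expectation_mono_finite)
    fix f ys
    let ?lo = "lo (map f is) ys" and ?hi = "hi (map f is) ys"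
    have nn: "0 \<le> (\<Sum>h\<in>C. ?lo * I (map f is) (map f (js h)) ys)"
      by (intro sum_nonneg mult_nonneg_nonneg nonneg)
    show "indicator {ys. \<exists>h\<in>C. pmf (dmc W (map f is)) ys \<le> pmf (dmc W (map f (js h))) ys} ys
        \<le> ?hi + (\<Sum>h\<in>C. ?lo * I (map f is) (map f (js h)) ys)"
    proof (cases "?hi = 1 \<or> \<not> (\<exists>h\<in>C. pmf (dmc W (map f is)) ys \<le> pmf (dmc W (map f (js h))) ys)")
      case True
      thus ?thesis using nn hl[of "map f is" ys] by (auto simp: indicator_def)
    next
      case False
      then obtain h where h: "h \<in> C" "pmf (dmc W (map f is)) ys \<le> pmf (dmc W (map f (js h))) ys" "?lo = 1"
        using hl[of "map f is" ys] by auto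
      have "1 = ?lo * I (map f is) (map f (js h)) ys" using h by (simp add: I_def)
      also have "\<dots> \<le> (\<Sum>h\<in>C. ?lo * I (map f is) (map f (js h)) ys)"
        using h(1) C(1) by (intro member_le_sum mult_nonneg_nonneg nonneg)
      finally show ?thesis using hl[of "map f is" ys] by (auto simp: indicator_def)
    qed
  qed (use A in auto)
  also have "\<dots> = measure_pmf.expectation ?F (\<lambda>f. measure_pmf.expectation (dmc W (map f is)) (hi (map f is))) +
      (\<Sum>h\<in>C. measure_pmf.expectation ?F (\<lambda>f. measure_pmf.expectation (dmc W (map f is)) (\<lambda>ys.
        lo (map f is) ys * I (map f is) (map f (js h)) ys)))"
    using A by (simp add: expectation_add_finite expectation_sum_finite)
  also have "\<dots> = measure_pmf.expectation ?X (\<lambda>xs. measure_pmf.expectation (dmc W xs) (hi xs)) +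
      (\<Sum>h\<in>C. measure_pmf.expectation ?X (\<lambda>xs. measure_pmf.expectation ?X (\<lambda>xs'.
         measure_pmf.expectation (dmc W xs) (\<lambda>ys. lo xs ys * I xs xs' ys))))"
    by (intro arg_cong2[of _ _ _ _ "(+)"] sum.cong refl EF[of "\<lambda>xs. measure_pmf.expectation (dmc W xs) (hi xs)"]
      EF2[of _ "\<lambda>xs xs'. measure_pmf.expectation (dmc W xs) (\<lambda>ys. lo xs ys * I xs xs' ys)"])
  also have "\<dots> \<le> measure_pmf.expectation ?X (\<lambda>xs. measure_pmf.expectation (dmc W xs) (hi xs)) +
      (\<Sum>h\<in>C. measure_pmf.expectation ?X (\<lambda>xs.
         measure_pmf.expectation (dmc W xs) (\<lambda>ys. lo xs ys * exp (- word_dens W xs ys))))"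
  proof (intro add_mono order.refl sum_mono expectation_mono_finite)
    fix xs assume "xs \<in> set_pmf ?X"
    hence xs: "length xs = ?N" by (simp add: set_replicate_pmf)
    have "measure_pmf.expectation ?X (\<lambda>xs'. measure_pmf.expectation (dmc W xs) (\<lambda>ys. lo xs ys * I xs xs' ys)) =
        measure_pmf.expectation (dmc W xs) (\<lambda>ys. lo xs ys * measure_pmf.expectation ?X (\<lambda>xs'. I xs xs' ys))"
      by (subst expectation_swap_finite) auto
    also have "\<dots> \<le> measure_pmf.expectation (dmc W xs) (\<lambda>ys. lo xs ys * exp (- word_dens W xs ys))"
    proof (intro expectation_mono_finite mult_left_mono)
      fix ys assume "ys \<in> set_pmf (dmc W xs)"
      moreover have "(\<lambda>xs'. I xs xs' ys) = indicator {xs'. pmf (dmc W xs) ys \<le> pmf (dmc W xs') ys}"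
        by (simp add: I_def indicator_def fun_eq_iff)
      ultimately show "measure_pmf.expectation ?X (\<lambda>xs'. I xs xs' ys) \<le> exp (- word_dens W xs ys)"
        using prob_random_word_le[of ys W xs] xs by simp
    qed (use nonneg in auto)
    finally show "measure_pmf.expectation ?X (\<lambda>xs'. measure_pmf.expectation (dmc W xs) (\<lambda>ys. lo xs ys * I xs xs' ys))
      \<le> measure_pmf.expectation (dmc W xs) (\<lambda>ys. lo xs ys * exp (- word_dens W xs ys))" .
  qed auto
  also have "\<dots> = measure_pmf.expectation ?X (\<lambda>xs. measure_pmf.expectation (dmc W xs)
      (\<lambda>ys. hi xs ys + card C * (lo xs ys * exp (- word_dens W xs ys))))"
    by (simp add: expectation_add_finite)
  also have "\<dots> \<le> measure_pmf.expectation ?X (\<lambda>xs. measure_pmf.expectation (dmc W xs)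
      (\<lambda>ys. L powr s * exp (- s * word_dens W xs ys)))"
  proof (intro expectation_mono_finite)
    fix xs ys
    \<comment> \<open>\<open>u\<close> is the union bound, and \<open>min 1 u \<le> u powr s\<close>
      for \<open>0 \<le> s \<le> 1\<close>.\<close>
    define u where "u = L * exp (- word_dens W xs ys)"
    have u: "u > 0" using C by (simp add: u_def)
    have "L powr s * exp (- s * word_dens W xs ys) = u powr s"
      using C by (simp add: u_def powr_def ln_mult algebra_simps flip: exp_add)
    moreover have "1 \<le> u powr s" if "1 \<le> u" using that s(1) by (rule ge_one_powr_ge_zero)
    moreover have "u \<le> u powr s" if "u < 1" using powr_mono'[of s 1 u] that u s by simp
    moreover have "card C * exp (- word_dens W xs ys) \<le> u" using C by (auto simp: u_def intro: mult_right_mono)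
    ultimately show "hi xs ys + card C * (lo xs ys * exp (- word_dens W xs ys)) \<le> L powr s * exp (- s * word_dens W xs ys)"
      unfolding lo_def hi_def u_def[symmetric] by auto
  qed auto
  also have "\<dots> = measure_pmf.expectation ?X (\<lambda>xs. L powr s * dens_mgf W (- s) ^ length xs)"
    unfolding integral_mult_right_zero expectation_exp_word_dens[OF sym] ..
  also have "\<dots> = measure_pmf.expectation ?X (\<lambda>xs. L powr s * dens_mgf W (- s) ^ length is)"
    by (intro expectation_cong_pmf) (simp add: set_replicate_pmf)
  finally show ?thesis by simp
qed

text \<open>One table entry per position and message prefix: position \<open>p\<close> lies in block
  \<open>p div n + 1\<close>, whose codeword may use that many messages. Beyond the last message
  \<open>take\<close> returns the whole list, which covers the final blocks.\<close>

definition tree_idx :: "nat \<Rightarrow> nat \<Rightarrow> nat \<Rightarrow> nat list \<Rightarrow> (nat \<times> nat list) list" where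
  "tree_idx n i j g = map (\<lambda>p. (p, take (p div n + 1) g)) [i * n..<j * n]"

definition tree_enc :: "nat \<Rightarrow> (nat \<times> nat list \<Rightarrow> 'x) \<Rightarrow> nat \<Rightarrow> nat list \<Rightarrow> 'x list" where
  "tree_enc n f k h = map (\<lambda>p. f (p, h)) [(k - 1) * n..<k * n]"

text \<open>Joint maximum likelihood over all messages that influence the first
  \<open>k + T - 1\<close> blocks, not over message \<open>k\<close> alone. A maximiser exists
  because the candidates are finitely many, see \<open>tree_dec_word_arg_max\<close>.\<close>

definition tree_dec_word ::
  "('x \<Rightarrow> 'y pmf) \<Rightarrow> nat \<Rightarrow> nat \<Rightarrow> nat \<Rightarrow> nat \<Rightarrow> (nat \<times> nat list \<Rightarrow> 'x) \<Rightarrow> nat \<Rightarrow> 'y list \<Rightarrow> nat list" where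
  "tree_dec_word W n M T S f k ys =
     (SOME h. is_arg_max (\<lambda>h. pmf (dmc W (map f (tree_idx n 0 (k + T - 1) h))) ys)
       (\<lambda>h. h \<in> msg_words M (min (k + T - 1) S)) h)"

definition tree_dec ::
  "('x \<Rightarrow> 'y pmf) \<Rightarrow> nat \<Rightarrow> nat \<Rightarrow> nat \<Rightarrow> nat \<Rightarrow> (nat \<times> nat list \<Rightarrow> 'x) \<Rightarrow> nat \<Rightarrow> 'y list \<Rightarrow> nat" where
  "tree_dec W n M T S f k ys = tree_dec_word W n M T S f k ys ! (k - 1)"

text \<open>\<open>j\<close> counts from 0: it is the number of messages that are right before the
  first wrong one.\<close>

definition competitors :: "nat \<Rightarrow> nat \<Rightarrow> nat \<Rightarrow> nat list \<Rightarrow> nat list set" where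
  "competitors M K j g = {h \<in> msg_words M K. take j h = take j g \<and> h ! j \<noteq> g ! j}"

lemma length_tree_idx [simp]: "length (tree_idx n i j g) = (j - i) * n"
  by (simp add: tree_idx_def diff_mult_distrib)

lemma tree_idx_append: "i \<le> j \<Longrightarrow> j \<le> l \<Longrightarrow> tree_idx n i l g = tree_idx n i j g @ tree_idx n j l g"
  using upt_add_eq_append[of "i * n" "j * n" "l * n - j * n"] mult_le_mono1[of i j n] mult_le_mono1[of j l n]
  by (simp add: tree_idx_def)

lemma block_index_less: "p < j * n \<Longrightarrow> p div n + 1 \<le> (j :: nat)"
  by (simp add: Suc_le_eq less_mult_imp_div_less)

lemma tree_idx_cong: "take j g = take j h \<Longrightarrow> tree_idx n i j g = tree_idx n i j h"
proof -
  assume eq: "take j g = take j h"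
  have "take m g = take m h" if "m \<le> j" for m
    using arg_cong[OF eq, of "take m"] that by (simp add: min_def)
  thus ?thesis unfolding tree_idx_def by (intro map_cong) (auto dest: block_index_less)
qed

lemma blocks_tree_enc:
  assumes "length g = S"
  shows "blocks (tree_enc n f) S 1 (m + 1) g = map f (tree_idx n 0 m g)"
proof (induction m)
  case (Suc m)
  have "p div n = m" if "p \<in> set [m * n..<Suc m * n]" for p
    using that by (intro div_nat_eqI) (auto simp: mult.commute)
  hence "map (\<lambda>p. f (p, take (min (Suc m) S) g)) [m * n..<Suc m * n] = map f (tree_idx n m (Suc m) g)"
    using assms by (simp add: tree_idx_def min_def)
  hence "blocks (tree_enc n f) S (m + 1) (Suc m + 1) g = map f (tree_idx n m (Suc m) g)"
    by (simp add: blocks_def tree_enc_def)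
  thus ?case using Suc.IH blocks_append[of 1 "m + 1" "Suc m + 1" "tree_enc n f" S g]
      tree_idx_append[of 0 m "Suc m" n g] by simp
qed (simp add: blocks_def tree_idx_def)

lemma distinct_tree_idx: "distinct (tree_idx n i j g)"
  by (auto simp: tree_idx_def distinct_map inj_on_def)

text \<open>A difference at index \<open>j\<close> persists in all longer prefixes, so from block
  \<open>j + 1\<close> on the two words read disjoint parts of the table.\<close>

lemma distinct_tree_idx_append:
  assumes "h ! j \<noteq> g ! j"
  shows "distinct (tree_idx n j m g @ tree_idx n j m h)"
proof -
  have ne: "take (p div n + 1) g \<noteq> take (p div n + 1) h" if "p \<in> set [j * n..<m * n]" for p
  proof
    assume eq: "take (p div n + 1) g = take (p div n + 1) h"
    have "j * n \<le> p" "n > 0" using that by (auto intro: gr0I)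
    hence "j \<le> p div n" by (simp add: less_eq_div_iff_mult_less_eq)
    hence "j < p div n + 1" by simp
    hence "g ! j = h ! j" using eq by (metis nth_take)
    thus False using assms by simp
  qed
  hence "set (tree_idx n j m g) \<inter> set (tree_idx n j m h) = {}" by (auto simp: tree_idx_def)
  thus ?thesis by (simp add: distinct_tree_idx)
qed

lemma card_msg_words: "card (msg_words M j) = M ^ j"
  using card_lists_length_eq[of "{1..M}" j] by (simp add: msg_words_def conj_commute)

text \<open>A competitor is determined by what follows the common prefix of length
  \<open>j\<close>.\<close>

lemma card_competitors:
  assumes "1 \<le> M" "K \<le> m"
  shows "card (competitors M K j g) \<le> M ^ (m - j)"
proof -
  have "inj_on (drop j) (competitors M K j g)"
    unfolding inj_on_def competitors_def by (metis (mono_tags, lifting) append_take_drop_id mem_Collect_eq)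
  moreover have "drop j ` competitors M K j g \<subseteq> msg_words M (K - j)"
    by (auto simp: competitors_def msg_words_def dest: in_set_dropD)
  ultimately have "card (competitors M K j g) \<le> card (msg_words M (K - j))"
    by (intro card_inj_on_le) auto
  also have "\<dots> \<le> M ^ (m - j)" unfolding card_msg_words using assms by (intro power_increasing) auto
  finally show ?thesis .
qed

lemma tree_dec_word_arg_max:
  assumes "1 \<le> M"
  shows "tree_dec_word W n M T S f k ys \<in> msg_words M (min (k + T - 1) S)"
    and "h \<in> msg_words M (min (k + T - 1) S) \<Longrightarrow>
      pmf (dmc W (map f (tree_idx n 0 (k + T - 1) h))) ys \<le>
      pmf (dmc W (map f (tree_idx n 0 (k + T - 1) (tree_dec_word W n M T S f k ys)))) ys"
proof -
  let ?G = "msg_words M (min (k + T - 1) S)"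
  let ?v = "\<lambda>h. pmf (dmc W (map f (tree_idx n 0 (k + T - 1) h))) ys"
  have "replicate (min (k + T - 1) S) 1 \<in> ?G" using assms by (auto simp: msg_words_def)
  hence "?G \<noteq> {}" by blast
  hence "Max (?v ` ?G) \<in> ?v ` ?G" by (intro Max_in) auto
  then obtain h0 where "h0 \<in> ?G" "?v h0 = Max (?v ` ?G)" by auto
  hence "is_arg_max ?v (\<lambda>h. h \<in> ?G) h0" by (auto simp: is_arg_max_linorder)
  hence "is_arg_max ?v (\<lambda>h. h \<in> ?G) (tree_dec_word W n M T S f k ys)"
    unfolding tree_dec_word_def by (rule someI)
  thus "tree_dec_word W n M T S f k ys \<in> ?G" and "h \<in> ?G \<Longrightarrow> ?v h \<le> ?v (tree_dec_word W n M T S f k ys)"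
    by (auto simp: is_arg_max_linorder)
qed

text \<open>Split by the first wrong message. Before it the true and the decoded list have the same
  codewords, so these likelihoods cancel and the comparison concerns the later blocks only.\<close>

lemma tree_dec_error_le:
  fixes W :: "'x \<Rightarrow> 'y::finite pmf"
  assumes M: "1 \<le> M" and T: "1 \<le> T" and k: "k \<in> {1..S}" and g: "g \<in> msg_words M S"
  defines "m \<equiv> k + T - 1"
  shows "measure_pmf.prob (dmc W (map f (tree_idx n 0 m g))) {ys. tree_dec W n M T S f k ys \<noteq> g ! (k - 1)} \<le>
    (\<Sum>j<k. measure_pmf.prob (dmc W (map f (tree_idx n j m g)))
      {ys. \<exists>h\<in>competitors M (min m S) j g.
        pmf (dmc W (map f (tree_idx n j m g))) ys \<le> pmf (dmc W (map f (tree_idx n j m h))) ys})"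
proof -
  let ?X = "\<lambda>i j h. map f (tree_idx n i j h)"
  define B where "B j = {ys. \<exists>h\<in>competitors M (min m S) j g. pmf (dmc W (?X j m g)) ys \<le> pmf (dmc W (?X j m h)) ys}" for j
  have km: "k \<le> m" "k \<le> min m S" using T k by (auto simp: m_def)
  have "measure_pmf.prob (dmc W (?X 0 m g)) {ys. tree_dec W n M T S f k ys \<noteq> g ! (k - 1)} \<le>
      measure_pmf.prob (dmc W (?X 0 m g)) (\<Union>j\<in>{..<k}. {ys. drop (j * n) ys \<in> B j})"
  proof (rule prob_mono_pmf)
    fix ys assume ys: "ys \<in> set_pmf (dmc W (?X 0 m g))" "ys \<in> {ys. tree_dec W n M T S f k ys \<noteq> g ! (k - 1)}"
    define h where "h = tree_dec_word W n M T S f k ys"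
    have h: "h \<in> msg_words M (min m S)" unfolding h_def m_def by (rule tree_dec_word_arg_max(1)[OF M])
    have diff: "h ! (k - 1) \<noteq> g ! (k - 1)" using ys(2) by (simp add: tree_dec_def h_def)
    have "take (min m S) g \<in> msg_words M (min m S)" using g by (auto simp: msg_words_def dest: in_set_takeD)
    hence "pmf (dmc W (?X 0 m (take (min m S) g))) ys \<le> pmf (dmc W (?X 0 m h)) ys"
      unfolding h_def m_def by (rule tree_dec_word_arg_max(2)[OF M])
    moreover have "tree_idx n 0 m (take (min m S) g) = tree_idx n 0 m g"
      using g by (intro tree_idx_cong) (simp add: msg_words_def min_def)
    ultimately have max: "pmf (dmc W (?X 0 m g)) ys \<le> pmf (dmc W (?X 0 m h)) ys" by simp
    \<comment> \<open>The lists differ at \<open>k - 1\<close>, so a first difference exists and is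
      at most \<open>k - 1\<close>.\<close>
    define j where "j = (LEAST j. h ! j \<noteq> g ! j)"
    have j: "h ! j \<noteq> g ! j" "j \<le> k - 1" "\<And>i. i < j \<Longrightarrow> h ! i = g ! i"
      unfolding j_def using LeastI[of "\<lambda>j. h ! j \<noteq> g ! j", OF diff]
        Least_le[of "\<lambda>j. h ! j \<noteq> g ! j", OF diff] not_less_Least[of _ "\<lambda>j. h ! j \<noteq> g ! j"] by blast+
    have jk: "j < k" using j(2) k by auto
    have len: "length h \<ge> k" "length g \<ge> k" using h g km k by (auto simp: msg_words_def)
    have take_eq: "take j h = take j g"
      using j(3) jk len by (intro nth_take_lemma) auto
    hence comp: "h \<in> competitors M (min m S) j g" using h j(1) by (simp add: competitors_def)
    have split: "?X 0 m h' = ?X 0 j h' @ ?X j m h'" for h'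
      using jk km by (simp add: tree_idx_append[of 0 j m] flip: map_append)
    have past: "?X 0 j h = ?X 0 j g" using tree_idx_cong[OF take_eq] by simp
    have len_ys: "length ys = m * n" using length_set_dmc[OF ys(1)] by simp
    have lt: "length (take (j * n) ys) = length (?X 0 j h')" for h'
      using len_ys jk km by (simp add: min_def)
    have "pmf (dmc W (?X 0 m h')) ys = pmf (dmc W (?X 0 j h')) (take (j * n) ys) * pmf (dmc W (?X j m h')) (drop (j * n) ys)" for h'
      using pmf_dmc_append[OF lt[of h'], of W "?X j m h'" "drop (j * n) ys"] by (simp only: split append_take_drop_id)
    note fac = this
    \<comment> \<open>The true word has positive likelihood at a received output, which permits
      division by the likelihood of the common past.\<close>
    have "pmf (dmc W (?X 0 m g)) ys > 0" using ys(1) by (rule pmf_positive)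
    hence "pmf (dmc W (?X 0 j g)) (take (j * n) ys) > 0"
      unfolding fac by (auto simp: zero_less_mult_iff)
    hence "pmf (dmc W (?X j m g)) (drop (j * n) ys) \<le> pmf (dmc W (?X j m h)) (drop (j * n) ys)"
      using max unfolding fac past by simp
    thus "ys \<in> (\<Union>j\<in>{..<k}. {ys. drop (j * n) ys \<in> B j})" using jk comp by (auto simp: B_def)
  qed
  also have "\<dots> \<le> (\<Sum>j\<in>{..<k}. measure_pmf.prob (dmc W (?X 0 m g)) {ys. drop (j * n) ys \<in> B j})"
    by (rule measure_UNION_le) auto
  also have "\<dots> = (\<Sum>j<k. measure_pmf.prob (dmc W (?X j m g)) (B j))"
  proof (rule sum.cong[OF refl])
    fix j assume "j \<in> {..<k}"
    hence "?X 0 m g = ?X 0 j g @ ?X j m g"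
      using km by (simp add: tree_idx_append[of 0 j m] flip: map_append)
    thus "measure_pmf.prob (dmc W (?X 0 m g)) {ys. drop (j * n) ys \<in> B j} = measure_pmf.prob (dmc W (?X j m g)) (B j)"
      using prob_dmc_append_drop[of W "?X 0 j g" "?X j m g" "\<lambda>ys. ys \<in> B j"] by simp
  qed
  finally show ?thesis unfolding B_def .
qed

text \<open>A first error at any index leaves at least \<open>T\<close> blocks to expose it, so the
  powers of the one-block factor sum to at most twice its \<open>T\<close>-th power once it is at
  most 1/2. The factor \<open>S\<close> arises because one table must serve all decoders.\<close>

theorem streaming_achievability:
  fixes W :: "'x::finite \<Rightarrow> 'y::finite pmf"
  assumes sym: "output_symmetric W" and M: "1 \<le> M" and T: "1 \<le> T" and S: "1 \<le> S"
    and s: "0 \<le> s" "s \<le> 1" and half: "real M powr s * dens_mgf W (- s) ^ n \<le> 1 / 2"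
  shows "\<exists>\<phi> \<psi>. streaming_code W n M (2 * real S * (real M powr s * dens_mgf W (- s) ^ n) ^ T) T S \<phi> \<psi>"
proof -
  define r where "r = real M powr s * dens_mgf W (- s) ^ n"
  have r: "0 \<le> r" "r \<le> 1 / 2" using half dens_mgf_pos[of W "- s"] by (auto simp: r_def)
  \<comment> \<open>All positions of the transmission with all possible prefixes: a finite index
    set, so the random table has finite support.\<close>
  let ?A = "{..<(S + T - 1) * n} \<times> {h. set h \<subseteq> {1..M} \<and> length h \<le> S}"
  let ?F = "Pi_pmf ?A undefined (\<lambda>_. pmf_of_set UNIV) :: (nat \<times> nat list \<Rightarrow> 'x) pmf"
  let ?R = "unif_msgs M S"
  define err where "err f k = streaming_error W n M T S (tree_enc n f) (tree_dec W n M T S f) k" for f k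
  have A: "finite ?A" by (intro finite_cartesian_product finite_lists_length_le) auto
  have finF: "finite (set_pmf ?F)" using A by simp
  have len_enc: "length (tree_enc n f k h) = n" if "1 \<le> k" for f :: "nat \<times> nat list \<Rightarrow> 'x" and k h
    using that by (simp add: tree_enc_def flip: diff_mult_distrib)
  have err_eq: "err f k = measure_pmf.expectation ?R (\<lambda>g. measure_pmf.prob (dmc W (map f (tree_idx n 0 (k + T - 1) g)))
      {ys. tree_dec W n M T S f k ys \<noteq> g ! (k - 1)})" if k: "k \<in> {1..S}" for f k
  proof -
    have "err f k = measure_pmf.expectation ?R (\<lambda>g. measure_pmf.prob (dmc W (blocks (tree_enc n f) S 1 (k + T) g))
        {ys. tree_dec W n M T S f k ys \<noteq> g ! (k - 1)})"
      unfolding err_def using M T k len_enc by (intro streaming_error_window) auto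
    also have "\<dots> = measure_pmf.expectation ?R (\<lambda>g. measure_pmf.prob (dmc W (map f (tree_idx n 0 (k + T - 1) g)))
        {ys. tree_dec W n M T S f k ys \<noteq> g ! (k - 1)})"
    proof (rule expectation_cong_pmf)
      fix g assume "g \<in> set_pmf ?R"
      hence "length g = S" using M by (simp add: set_unif_msgs msg_words_def)
      thus "measure_pmf.prob (dmc W (blocks (tree_enc n f) S 1 (k + T) g)) {ys. tree_dec W n M T S f k ys \<noteq> g ! (k - 1)} =
          measure_pmf.prob (dmc W (map f (tree_idx n 0 (k + T - 1) g))) {ys. tree_dec W n M T S f k ys \<noteq> g ! (k - 1)}"
        using blocks_tree_enc[of g S n f "k + T - 1"] T by simp
    qed
    finally show ?thesis .
  qed
  have avg: "measure_pmf.expectation ?F (\<lambda>f. err f k) \<le> 2 * r ^ T" if k: "k \<in> {1..S}" for k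
  proof -
    define m where "m = k + T - 1"
    let ?ev = "\<lambda>f g j. measure_pmf.prob (dmc W (map f (tree_idx n j m g)))
      {ys. \<exists>h\<in>competitors M (min m S) j g.
        pmf (dmc W (map f (tree_idx n j m g))) ys \<le> pmf (dmc W (map f (tree_idx n j m h))) ys}"
    have "measure_pmf.expectation ?F (\<lambda>f. err f k) \<le>
        measure_pmf.expectation ?F (\<lambda>f. measure_pmf.expectation ?R (\<lambda>g. \<Sum>j<k. ?ev f g j))"
      unfolding err_eq[OF k] m_def using finF M
      by (intro expectation_mono_finite tree_dec_error_le M T k) (auto simp: set_unif_msgs)
    also have "\<dots> = measure_pmf.expectation ?R (\<lambda>g. \<Sum>j<k. measure_pmf.expectation ?F (\<lambda>f. ?ev f g j))"
      using finF M by (subst expectation_swap_finite) (auto simp: expectation_sum_finite)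
    also have "\<dots> \<le> measure_pmf.expectation ?R (\<lambda>g. \<Sum>j<k. r ^ (m - j))"
    proof (intro expectation_mono_finite sum_mono)
      fix g j assume "g \<in> set_pmf ?R" "j \<in> {..<k}"
      hence g: "g \<in> msg_words M S" and j: "j < k" using M by (auto simp: set_unif_msgs)
      have sub: "set (tree_idx n j m h) \<subseteq> ?A" if "set h \<subseteq> {1..M}" "length h \<le> S" for h
      proof -
        have "m * n \<le> (S + T - 1) * n" using k by (intro mult_le_mono1) (auto simp: m_def)
        hence "p < (S + T - 1) * n" if "p < m * n" for p using that by (rule less_le_trans[rotated])
        thus ?thesis using that by (auto simp: tree_idx_def dest!: in_set_takeD)
      qed
      have "measure_pmf.expectation ?F (\<lambda>f. ?ev f g j) \<le>
          (real M ^ (m - j)) powr s * dens_mgf W (- s) ^ length (tree_idx n j m g)"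
      proof (rule random_coding_union_bound[OF sym A])
        show "set (tree_idx n j m g) \<subseteq> ?A" using g by (intro sub) (auto simp: msg_words_def)
        show "finite (competitors M (min m S) j g)" by (simp add: competitors_def)
        show "real (card (competitors M (min m S) j g)) \<le> real M ^ (m - j)"
          using card_competitors[OF M, of "min m S" m j g] by (simp flip: of_nat_power)
        show "0 < real M ^ (m - j)" using M by simp
        fix h assume h: "h \<in> competitors M (min m S) j g"
        show "distinct (tree_idx n j m g @ tree_idx n j m h) \<and> set (tree_idx n j m h) \<subseteq> ?A \<and>
            length (tree_idx n j m h) = length (tree_idx n j m g)"
          using h distinct_tree_idx_append[of h j g n m] sub[of h] by (auto simp: competitors_def msg_words_def)
      qed (use s distinct_tree_idx in auto)
      also have "\<dots> = r ^ (m - j)"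
        using M by (simp add: r_def power_mult_distrib powr_power powr_powr mult.commute power_mult flip: powr_realpow)
      finally show "measure_pmf.expectation ?F (\<lambda>f. ?ev f g j) \<le> r ^ (m - j)" .
    qed (use M in auto)
    also have "\<dots> = (\<Sum>j<k. r ^ (m - j))" by simp
    \<comment> \<open>With \<open>j = k - 1 - i\<close> the exponent becomes
      \<open>T + i\<close>.\<close>
    also have "\<dots> = (\<Sum>i<k. r ^ (m - (k - Suc i)))" by (rule sum.nat_diff_reindex[symmetric])
    also have "\<dots> = (\<Sum>i<k. r ^ T * r ^ i)"
      using T by (intro sum.cong) (auto simp: m_def simp flip: power_add)
    also have "\<dots> \<le> r ^ T * (\<Sum>i<k. (1 / 2) ^ i)"
      unfolding sum_distrib_left[symmetric] using r by (intro mult_left_mono sum_mono power_mono) auto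
    also have "\<dots> \<le> r ^ T * 2"
      using r by (intro mult_left_mono) (simp_all add: sum_gp_strict)
    finally show ?thesis by (simp add: mult.commute)
  qed
  \<comment> \<open>Separate averages would give a table for each \<open>k\<close>; the average of
    the sum gives one table for all.\<close>
  have "measure_pmf.expectation ?F (\<lambda>f. \<Sum>k\<in>{1..S}. err f k) \<le> (\<Sum>k\<in>{1..S}. 2 * r ^ T)"
    using finF avg by (simp only: expectation_sum_finite) (intro sum_mono)
  hence "measure_pmf.expectation ?F (\<lambda>f. \<Sum>k\<in>{1..S}. err f k) \<le> 2 * real S * r ^ T" by simp
  from expectation_le_imp_exists[OF finF this] obtain f where f: "(\<Sum>k\<in>{1..S}. err f k) \<le> 2 * real S * r ^ T"
    by blast
  have "err f k \<le> 2 * real S * r ^ T" if "k \<in> {1..S}" for k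
  proof -
    have "err f k \<le> (\<Sum>k\<in>{1..S}. err f k)"
      using that by (intro member_le_sum) (auto simp: err_def streaming_error_def)
    thus ?thesis using f by simp
  qed
  hence "Max (err f ` {1..S}) \<le> 2 * real S * r ^ T" using S by (subst Max_le_iff) auto
  moreover have "tree_dec W n M T S f k ys \<in> {1..M}" if "k \<in> {1..S}" for k ys
  proof -
    have "k - 1 < min (k + T - 1) S" using that T by auto
    thus ?thesis using tree_dec_word_arg_max(1)[OF M, of W n T S f k ys] unfolding tree_dec_def msg_words_def
      by (metis (mono_tags, lifting) mem_Collect_eq nth_mem subsetD)
  qed
  ultimately have "streaming_code W n M (2 * real S * r ^ T) T S (tree_enc n f) (tree_dec W n M T S f)"
    using M T S len_enc unfolding streaming_code_def err_def by auto
  thus ?thesis unfolding r_def by blast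
qed

subsection \<open>Moderate deviations\<close>

lemma real_powr_neg_tendsto_0: "0 < t \<Longrightarrow> (\<lambda>n. real n powr - t) \<longlonglongrightarrow> 0"
  by real_asymp

text \<open>At an argument of order \<open>n powr - t\<close>, \<open>n\<close> channel uses
  contribute an exponent of order \<open>n powr (1 - 2 * t)\<close>. The limit in
  \<open>dens_cgf_limit\<close> excludes the point 0, hence the case \<open>c = 0\<close>.\<close>

lemma dens_cgf_scaled_limit:
  fixes W :: "'x::finite \<Rightarrow> 'y::finite pmf"
  assumes "0 < t"
  shows "(\<lambda>n. real n powr (2 * t) * dens_cgf W (c * real n powr - t)) \<longlonglongrightarrow> c\<^sup>2 * (dens_var W / 2)"
proof (cases "c = 0")
  case True
  thus ?thesis by (simp add: dens_cgf_def dens_mgf_def)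
next
  case False
  define s where "s n = c * real n powr - t" for n
  have pos: "eventually (\<lambda>n. n > 0) sequentially" by (rule eventually_gt_at_top)
  have "s \<longlonglongrightarrow> 0"
    unfolding s_def using real_powr_neg_tendsto_0[OF assms] by (rule tendsto_mult_right_zero)
  moreover have "eventually (\<lambda>n. s n \<noteq> 0) sequentially"
    using pos by eventually_elim (use False in \<open>simp add: s_def\<close>)
  ultimately have "filterlim s (at 0) sequentially" by (simp add: filterlim_at)
  hence "(\<lambda>n. c\<^sup>2 * (dens_cgf W (s n) / (s n)\<^sup>2)) \<longlonglongrightarrow> c\<^sup>2 * (dens_var W / 2)"
    by (intro tendsto_mult_left filterlim_compose[OF dens_cgf_limit])
  moreover have "eventually (\<lambda>n. c\<^sup>2 * (dens_cgf W (s n) / (s n)\<^sup>2) =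
      real n powr (2 * t) * dens_cgf W (s n)) sequentially"
    using pos
  proof eventually_elim
    case (elim n)
    have "real n powr (2 * t) = (real n powr t)\<^sup>2" using elim by (simp add: powr_power mult.commute)
    thus ?case using False elim by (simp add: s_def power_mult_distrib powr_minus field_simps)
  qed
  ultimately show ?thesis unfolding s_def by (rule Lim_transform_eventually)
qed

lemma moderate_log_size_at_top:
  fixes m \<beta> t :: real
  assumes "0 < m" "0 < t" "t < 1"
  shows "filterlim (\<lambda>n. real n * m - \<beta> * real n powr (1 - t)) at_top sequentially"
proof -
  have "(\<lambda>n. m - \<beta> * real n powr - t) \<longlonglongrightarrow> m - \<beta> * 0"
    by (intro tendsto_intros real_powr_neg_tendsto_0 assms)
  hence "filterlim (\<lambda>n. (m - \<beta> * real n powr - t) * real n) at_top sequentially"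
    by (intro filterlim_tendsto_pos_mult_at_top filterlim_real_sequentially) (use assms in auto)
  moreover have "eventually (\<lambda>n. (m - \<beta> * real n powr - t) * real n =
      real n * m - \<beta> * real n powr (1 - t)) sequentially"
    using eventually_gt_at_top[of 0]
    by eventually_elim (simp add: algebra_simps powr_diff powr_minus divide_inverse)
  ultimately show ?thesis by (rule filterlim_cong[THEN iffD1, OF refl refl, rotated])
qed

lemma exp_tendsto_0_of_rate:
  fixes f a :: "nat \<Rightarrow> real"
  assumes "(\<lambda>n. f n / a n) \<longlonglongrightarrow> l" "l < 0" "filterlim a at_top sequentially"
  shows "(\<lambda>n. exp (f n)) \<longlonglongrightarrow> 0"
proof -
  have "filterlim (\<lambda>n. f n / a n * a n) at_bot sequentially"
    by (rule filterlim_tendsto_neg_mult_at_bot[OF assms])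
  moreover have "eventually (\<lambda>n. f n / a n * a n = f n) sequentially"
    using filterlim_at_top_dense[THEN iffD1, OF assms(3), rule_format, of 0] by eventually_elim simp
  ultimately have "filterlim f at_bot sequentially"
    by (rule filterlim_cong[THEN iffD1, OF refl refl, rotated])
  thus ?thesis by (rule filterlim_compose[OF exp_at_bot])
qed

text \<open>The setting in nats: \<beta> will be \<open>ln b\<close>, which converts the backoff
  from the rate to nats. As message set sizes are integers, \<open>M n\<close> is prescribed only to
  within distance 1.\<close>

locale moderate_regime =
  fixes W :: "'x::finite \<Rightarrow> 'y::finite pmf" and T :: nat and \<beta> t :: real and M S :: "nat \<Rightarrow> nat"
  assumes sym: "output_symmetric W"
    and var: "dens_var W > 0"
    and T: "T \<ge> 1"
    and \<beta>: "\<beta> > 0"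
    and t: "0 < t" "t < 1 / 3"
    and M: "\<forall>n\<ge>1. \<bar>real (M n) - exp (real n * dens_mean W - \<beta> * real n powr (1 - t))\<bar> < 1"
    and S_large: "(\<lambda>n. real (S n)) \<in> \<omega>(\<lambda>n. real n powr t)"
    and S_small: "(\<lambda>n. ln (real (S n)) / real n powr (1 - 2 * t)) \<longlonglongrightarrow> 0"
begin

abbreviation "a n \<equiv> real n powr (1 - 2 * t)"

lemma a_at_top: "filterlim a at_top sequentially"
  using t by real_asymp

lemma mean_pos: "dens_mean W > 0" using dens_mean_pos[OF var] .

text \<open>The prescribed size tends to infinity, so rounding alters it by a factor of at most
  2.\<close>

lemma ev_M: "eventually (\<lambda>n. 1 \<le> M n \<and>
    real n * dens_mean W - \<beta> * real n powr (1 - t) - ln 2 \<le> ln (real (M n)) \<and>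
    ln (real (M n)) \<le> real n * dens_mean W - \<beta> * real n powr (1 - t) + ln 2) sequentially"
proof -
  have "filterlim (\<lambda>n. real n * dens_mean W - \<beta> * real n powr (1 - t)) at_top sequentially"
    using mean_pos t by (intro moderate_log_size_at_top) auto
  hence "eventually (\<lambda>n. ln 2 \<le> real n * dens_mean W - \<beta> * real n powr (1 - t)) sequentially"
    by (simp add: filterlim_at_top)
  with eventually_ge_at_top[of 1] show ?thesis
  proof eventually_elim
    case (elim n)
    define X where "X = exp (real n * dens_mean W - \<beta> * real n powr (1 - t))"
    have "exp (ln 2) \<le> X" unfolding X_def exp_le_cancel_iff by (rule elim(2))
    hence X: "2 \<le> X" by simp
    have "\<bar>real (M n) - X\<bar> < 1" using M elim(1) by (simp add: X_def)
    hence b: "X / 2 \<le> real (M n)" "real (M n) \<le> 2 * X" "1 \<le> real (M n)" using X by auto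
    have "ln (X / 2) \<le> ln (real (M n))" "ln (real (M n)) \<le> ln (2 * X)"
      using b X by (subst ln_le_cancel_iff; simp)+
    thus ?case using b(3) X by (simp add: ln_div ln_mult X_def)
  qed
qed

lemma ev_S: "eventually (\<lambda>n. K * real n powr t \<le> real (S n)) sequentially"
proof -
  have "eventually (\<lambda>n. norm (real (S n)) \<ge> (\<bar>K\<bar> + 1) * norm (real n powr t)) sequentially"
    by (rule landau_omega.smallD[OF S_large]) simp
  thus ?thesis
  proof eventually_elim
    case (elim n)
    have "K * real n powr t \<le> (\<bar>K\<bar> + 1) * real n powr t" by (intro mult_right_mono) auto
    thus ?case using elim by simp
  qed
qed

lemma ev_S1: "eventually (\<lambda>n. 1 \<le> S n) sequentially"
  using ev_S[of 1] eventually_ge_at_top[of 1]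
proof eventually_elim
  case (elim n)
  have "1 \<le> real n powr t" using elim(2) t by (intro ge_one_powr_ge_zero) auto
  thus ?case using elim(1) by linarith
qed

lemma S_small': "(\<lambda>n. ln (2 * real (S n)) / a n) \<longlonglongrightarrow> 0"
proof -
  have "(\<lambda>n. ln 2 / a n) \<longlonglongrightarrow> 0" using t by real_asymp
  hence "(\<lambda>n. ln 2 / a n + ln (real (S n)) / a n) \<longlonglongrightarrow> 0 + 0" by (intro tendsto_add S_small)
  moreover have "eventually (\<lambda>n. ln 2 / a n + ln (real (S n)) / a n = ln (2 * real (S n)) / a n) sequentially"
    using ev_S1 by eventually_elim (simp add: ln_mult add_divide_distrib)
  ultimately show ?thesis by (simp add: Lim_transform_eventually)
qed

text \<open>The exponent in nats: \<open>T\<close> times the maximum of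
  \<open>c * \<beta> - c^2 * v / 2\<close> over \<open>c\<close>, where \<open>v\<close> is the
  variance.\<close>

definition rate :: real where "rate = real T * \<beta>\<^sup>2 / (2 * dens_var W)"

text \<open>The choice \<open>s = (\<beta> / v) n\<^sup>-\<^sup>t\<close> minimises the quadratic \<open>- s \<beta> n\<^sup>1\<^sup>-\<^sup>t + n s\<^sup>2 v / 2\<close>.\<close>

lemma achievability_rate:
  "\<exists>g. g \<longlonglongrightarrow> rate \<and> eventually (\<lambda>n. \<exists>\<epsilon> \<phi> \<psi>. streaming_code W n (M n) \<epsilon> T (S n) \<phi> \<psi> \<and>
     0 < \<epsilon> \<and> g n \<le> - ln \<epsilon> / a n) sequentially"
proof -
  define c where "c = \<beta> / dens_var W"
  have c: "c > 0" using var \<beta> by (simp add: c_def)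
  define s where "s n = c * real n powr - t" for n
  \<comment> \<open>\<open>E n\<close> bounds the logarithm of the one-block factor from above;
    \<open>ln 2\<close> pays for the rounding of \<open>M n\<close>.\<close>
  define E where "E n = s n * (ln 2 - \<beta> * real n powr (1 - t)) + real n * dens_cgf W (- s n)" for n
  define g where "g n = - (ln (2 * real (S n)) / a n) - real T * (E n / a n)" for n
  have E_lim: "(\<lambda>n. E n / a n) \<longlonglongrightarrow> - (\<beta>\<^sup>2 / (2 * dens_var W))"
  proof -
    have "(\<lambda>n. c * real n powr - t * ln 2 / a n) \<longlonglongrightarrow> 0" using t by real_asymp
    hence "(\<lambda>n. c * real n powr - t * ln 2 / a n - c * \<beta> +
        real n powr (2 * t) * dens_cgf W ((- c) * real n powr - t)) \<longlonglongrightarrow> 0 - c * \<beta> + (- c)\<^sup>2 * (dens_var W / 2)"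
      using t by (intro tendsto_intros dens_cgf_scaled_limit)
    also have "0 - c * \<beta> + (- c)\<^sup>2 * (dens_var W / 2) = - (\<beta>\<^sup>2 / (2 * dens_var W))"
      using var by (simp add: c_def power2_eq_square field_simps)
    finally show ?thesis
    proof (rule Lim_transform_eventually)
      show "eventually (\<lambda>n. c * real n powr - t * ln 2 / a n - c * \<beta> +
        real n powr (2 * t) * dens_cgf W ((- c) * real n powr - t) = E n / a n) sequentially"
        using eventually_gt_at_top[of 0]
      proof eventually_elim
        case (elim n)
        have an: "a n > 0" using elim by simp
        define K where "K = dens_cgf W ((- c) * real n powr - t)"
        have "E n = c * real n powr - t * ln 2 - c * \<beta> * (real n powr - t * real n powr (1 - t)) + real n * K"
          by (simp add: E_def s_def K_def right_diff_distrib)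
        also have "real n powr - t * real n powr (1 - t) = a n" by (simp flip: powr_add)
        also have "real n * K = real n powr (2 * t) * a n * K" using elim by (simp flip: powr_add)
        finally have "E n / a n = (c * real n powr - t * ln 2 - c * \<beta> * a n + real n powr (2 * t) * a n * K) / a n"
          by (simp only:)
        also have "\<dots> = c * real n powr - t * ln 2 / a n - c * \<beta> + real n powr (2 * t) * K"
          using an by (simp add: add_divide_distrib diff_divide_distrib)
        finally show ?case by (simp only: K_def)
      qed
    qed
  qed
  have "g \<longlonglongrightarrow> - 0 - real T * (- (\<beta>\<^sup>2 / (2 * dens_var W)))"
    unfolding g_def by (intro tendsto_intros S_small' E_lim)
  hence "g \<longlonglongrightarrow> rate" by (simp add: rate_def)
  \<comment> \<open>\<open>E n\<close> tends to minus infinity, which secures the bound 1/2 that the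
    geometric sum requires.\<close>
  moreover have "eventually (\<lambda>n. exp (E n) < 1 / 2) sequentially"
  proof -
    have "(\<lambda>n. exp (E n)) \<longlonglongrightarrow> 0"
      by (rule exp_tendsto_0_of_rate[OF E_lim _ a_at_top]) (use \<beta> var in auto)
    thus ?thesis by (rule order_tendstoD) simp
  qed
  moreover have "eventually (\<lambda>n. s n < 1) sequentially"
  proof -
    have "s \<longlonglongrightarrow> 0" unfolding s_def using t by real_asymp
    thus ?thesis by (rule order_tendstoD) simp
  qed
  ultimately have "eventually (\<lambda>n. exp (E n) < 1 / 2 \<and> s n < 1) sequentially" and g: "g \<longlonglongrightarrow> rate"
    by (auto intro: eventually_conj)
  from this(1) ev_M ev_S1 eventually_gt_at_top[of 0]
  have "eventually (\<lambda>n. \<exists>\<epsilon> \<phi> \<psi>. streaming_code W n (M n) \<epsilon> T (S n) \<phi> \<psi> \<and>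
     0 < \<epsilon> \<and> g n \<le> - ln \<epsilon> / a n) sequentially"
  proof eventually_elim
    case (elim n)
    define r where "r = real (M n) powr s n * dens_mgf W (- s n) ^ n"
    have sn: "0 \<le> s n" using c by (simp add: s_def)
    have M1: "real (M n) > 0" using elim by simp
    have r_eq: "r = exp (s n * ln (real (M n)) + real n * (- s n * dens_mean W + dens_cgf W (- s n)))"
      using M1 by (simp add: r_def powr_def dens_mgf_eq_exp exp_of_nat_mult exp_add flip: exp_of_nat_mult)
    have "s n * ln (real (M n)) \<le> s n * (real n * dens_mean W - \<beta> * real n powr (1 - t) + ln 2)"
      using elim sn by (intro mult_left_mono) auto
    hence r_le: "s n * ln (real (M n)) + real n * (- s n * dens_mean W + dens_cgf W (- s n)) \<le> E n"
      by (simp add: E_def algebra_simps)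
    hence "r \<le> 1 / 2" using elim(1) unfolding r_eq by (smt (verit) exp_le_cancel_iff)
    then obtain \<phi> \<psi> where code: "streaming_code W n (M n) (2 * real (S n) * r ^ T) T (S n) \<phi> \<psi>"
      using streaming_achievability[OF sym _ T _ sn, of "M n" "S n" n] elim unfolding r_def by auto
    have rpos: "r > 0" by (simp add: r_eq)
    have "ln (2 * real (S n) * r ^ T) = ln (2 * real (S n)) + real T * ln r"
      using elim rpos by (simp add: ln_mult ln_realpow)
    also have "\<dots> \<le> ln (2 * real (S n)) + real T * E n"
      using r_le by (simp add: r_eq mult_left_mono)
    finally have "- (ln (2 * real (S n)) + real T * E n) / a n \<le> - ln (2 * real (S n) * r ^ T) / a n"
      by (intro divide_right_mono) auto
    moreover have "g n = - (ln (2 * real (S n)) + real T * E n) / a n"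
      by (simp add: g_def diff_divide_distrib)
    ultimately have "g n \<le> - ln (2 * real (S n) * r ^ T) / a n" by simp
    moreover have "0 < 2 * real (S n) * r ^ T" using rpos elim by simp
    ultimately show ?case using code by blast
  qed
  with g show ?thesis by blast
qed

text \<open>A tilt with \<open>c > \<beta> / v\<close> pulls the mean density per channel use, to
  first order \<open>C - c * v * n powr - t\<close>, below the rate
  \<open>C - \<beta> * n powr - t\<close>. Each of the three unwanted terms of
  \<open>streaming_converse\<close> then falls below 1/6.\<close>

lemma converse_rate_aux:
  assumes c: "\<beta> / dens_var W < c" and \<rho>: "0 < \<rho>" and \<alpha>: "real T * (c\<^sup>2 * (dens_var W / 2)) * (1 + \<rho>) < \<alpha>"
  shows "eventually (\<lambda>n. \<forall>\<epsilon> \<phi> \<psi>. streaming_code W n (M n) \<epsilon> T (S n) \<phi> \<psi> \<longrightarrow>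
    exp (- \<alpha> * a n) / (2 * real (S n)) \<le> \<epsilon>) sequentially"
proof -
  define v where "v = dens_var W"
  define m where "m = dens_mean W"
  have v: "v > 0" using var by (simp add: v_def)
  have cpos: "c > 0" using c \<beta> v unfolding v_def by (meson divide_pos_pos less_trans)
  have "\<beta> < c * v" using c v by (simp add: v_def field_simps)
  \<comment> \<open>\<open>x\<close> separates the rate deficit \<beta> from the drop
    \<open>c * v\<close> of the mean density. The gap up to \<open>c * v\<close> makes
    \<open>c1\<close> small, the gap down to \<beta> makes \<open>c2\<close> small.\<close>
  then obtain x where x: "\<beta> < x" "x < c * v" using dense by blast
  define \<theta> where "\<theta> n = c * real n powr - t" for n
  \<comment> \<open>\<open>y = c - x / v\<close> minimises \<open>y * x + (y - c)^2 * v / 2\<close>,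
    the leading part of the Chernoff exponent.\<close>
  define \<mu> where "\<mu> n = (c - x / v) * real n powr - t" for n
  define \<xi> where "\<xi> n = x * real n powr - t" for n
  define N where "N n = real ((S n + T - 1) * n)" for n
  have cx: "0 < c - x / v" using x v by (simp add: field_simps)
  have lim0: "(\<lambda>n. real n powr - t) \<longlonglongrightarrow> 0" using t by (intro real_powr_neg_tendsto_0)
  have \<theta>_lim: "\<theta> \<longlonglongrightarrow> 0" unfolding \<theta>_def using lim0 by (rule tendsto_mult_right_zero)
  have powr_eq: "real n powr (2 * t) * (real n powr - t * real n powr - t) = 1" if "n > 0" for n
    using that by (simp flip: powr_add)
  have a_eq: "real n = real n powr (2 * t) * a n" if "n > 0" for n
    using that by (simp flip: powr_add)
  have N_ge: "real n \<le> N n" if "1 \<le> S n" for n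
  proof -
    have "1 * n \<le> (S n + T - 1) * n" using that T by (intro mult_le_mono1) auto
    thus ?thesis by (simp only: N_def of_nat_le_iff mult_1)
  qed

  define c1 where "c1 n = exp (N n * (\<mu> n * \<xi> n + dens_cgf W (\<mu> n - \<theta> n) - dens_cgf W (- \<theta> n)))" for n
  have ev1: "eventually (\<lambda>n. c1 n < 1 / 6) sequentially"
  proof -
    \<comment> \<open>\<open>- k0\<close> is that minimum less \<open>c^2 * v / 2\<close>, the
      contribution of \<open>dens_cgf W (- \<theta> n)\<close>.\<close>
    define k0 where "k0 = (c * v - x)\<^sup>2 / (2 * v)"
    have k0: "k0 > 0" using x v by (simp add: k0_def)
    define q where "q n = \<mu> n * \<xi> n + dens_cgf W (\<mu> n - \<theta> n) - dens_cgf W (- \<theta> n)" for n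
    have "(\<lambda>n. (c - x / v) * x + real n powr (2 * t) * dens_cgf W ((- x / v) * real n powr - t)
        - real n powr (2 * t) * dens_cgf W ((- c) * real n powr - t)) \<longlonglongrightarrow>
        (c - x / v) * x + (- x / v)\<^sup>2 * (dens_var W / 2) - (- c)\<^sup>2 * (dens_var W / 2)"
      using t by (intro tendsto_intros dens_cgf_scaled_limit)
    also have "(c - x / v) * x + (- x / v)\<^sup>2 * (dens_var W / 2) - (- c)\<^sup>2 * (dens_var W / 2) = - k0"
      using v unfolding v_def[symmetric] k0_def by (simp add: power2_eq_square field_simps)
    finally have "(\<lambda>n. real n powr (2 * t) * q n) \<longlonglongrightarrow> - k0"
    proof (rule Lim_transform_eventually)
      show "eventually (\<lambda>n. (c - x / v) * x + real n powr (2 * t) * dens_cgf W ((- x / v) * real n powr - t)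
        - real n powr (2 * t) * dens_cgf W ((- c) * real n powr - t) = real n powr (2 * t) * q n) sequentially"
        using eventually_gt_at_top[of 0]
      proof eventually_elim
        case (elim n)
        have "\<mu> n - \<theta> n = (- x / v) * real n powr - t" by (simp add: \<mu>_def \<theta>_def algebra_simps)
        moreover have "- \<theta> n = (- c) * real n powr - t" by (simp add: \<theta>_def)
        moreover have "real n powr (2 * t) * (\<mu> n * \<xi> n) = (c - x / v) * x"
          using powr_eq[OF elim] by (simp add: \<mu>_def \<xi>_def mult_ac)
        ultimately show ?case unfolding q_def by (simp only: right_diff_distrib distrib_left)
      qed
    qed
    hence "eventually (\<lambda>n. real n powr (2 * t) * q n < - k0 / 2) sequentially"
      by (rule order_tendstoD) (use k0 in simp)
    moreover have "(\<lambda>n. exp (- k0 / 2 * a n)) \<longlonglongrightarrow> 0" using k0 t by real_asymp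
    hence "eventually (\<lambda>n. exp (- k0 / 2 * a n) < 1 / 6) sequentially" by (rule order_tendstoD) simp
    ultimately show ?thesis using ev_S1 eventually_gt_at_top[of 0]
    proof eventually_elim
      case (elim n)
      have an: "a n > 0" using elim by simp
      have p: "real n powr (2 * t) > 0" using elim by simp
      have "q n < 0" using elim(1) k0 p by (smt (verit) mult_nonneg_nonneg field_sum_of_halves)
      \<comment> \<open>The exponent per channel use is negative, so \<open>n\<close> of the
        \<open>N n\<close> uses are enough.\<close>
      hence "N n * q n \<le> real n * q n" using N_ge[OF elim(3)] by (intro mult_right_mono_neg) auto
      also have "real n * q n = a n * (real n powr (2 * t) * q n)" using a_eq elim(4) by (metis mult.assoc mult.commute)
      also have "\<dots> \<le> a n * (- k0 / 2)" using elim(1) an by (intro mult_left_mono) auto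
      finally have "c1 n \<le> exp (- k0 / 2 * a n)" by (simp add: c1_def q_def mult.commute)
      thus ?case using elim(2) by simp
    qed
  qed

  define c2 where "c2 n = exp (N n * (m - \<xi> n * (1 - \<theta> n))) * (1 / real (M n)) ^ S n" for n
  have ev2: "eventually (\<lambda>n. c2 n < 1 / 6) sequentially"
  proof -
    \<comment> \<open>Here the growth of \<open>S\<close> decides: with
      \<open>S n \<ge> K * n powr t\<close>, the total deficit of at least
      \<open>S n * n powr (1 - t) * (x - \<beta>) / 2\<close> nats exceeds by \<open>n\<close> the
      \<open>T * n * m\<close> nats that bound the gain from the extra blocks.\<close>
    define K where "K = (real T * m + 1) * 2 / (x - \<beta>)"
    define w where "w n = x * (1 - \<theta> n) - \<beta> - ln 2 * real n powr (t - 1)" for n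
    have "(\<lambda>n. real n powr (t - 1)) \<longlonglongrightarrow> 0" using t by real_asymp
    hence "w \<longlonglongrightarrow> x * (1 - 0) - \<beta> - ln 2 * 0"
      unfolding w_def by (intro tendsto_intros \<theta>_lim)
    hence "eventually (\<lambda>n. (x - \<beta>) / 2 < w n) sequentially"
      by (rule order_tendstoD) (use x in simp)
    moreover have "eventually (\<lambda>n. \<theta> n < 1) sequentially" using \<theta>_lim by (rule order_tendstoD) simp
    moreover have "(\<lambda>n. exp (- real n)) \<longlonglongrightarrow> 0" by real_asymp
    hence "eventually (\<lambda>n. exp (- real n) < 1 / 6) sequentially" by (rule order_tendstoD) simp
    ultimately show ?thesis using ev_S[of K] ev_M ev_S1 eventually_gt_at_top[of 0]
    proof eventually_elim
      case (elim n)
      note w = elim(1) and th = elim(2) and SK = elim(4) and Mn = elim(5) and n = elim(7)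
      have M1: "real (M n) > 0" using Mn by simp
      have m: "m > 0" using mean_pos by (simp add: m_def)
      have wpos: "w n > 0" using w x by simp
      define P where "P = real n powr (1 - t)"
      have nP: "real n * real n powr - t = P" "P * real n powr (t - 1) = 1" "P * real n powr t = real n"
        using n by (simp_all add: P_def powr_mult_base flip: powr_add)
      have P: "P > 0" using n by (simp add: P_def)
      have Nn: "N n = (real (S n) + real T - 1) * real n" using T by (simp add: N_def of_nat_diff)
      have xth: "0 \<le> x * (1 - \<theta> n)" using x \<beta> th by simp
      have "c2 n = exp (N n * (m - \<xi> n * (1 - \<theta> n)) - real (S n) * ln (real (M n)))"
        using M1 by (simp add: c2_def exp_diff exp_of_nat_mult power_divide)
      also have "N n * (m - \<xi> n * (1 - \<theta> n)) =
          (real (S n) + real T - 1) * (real n * m) - (real (S n) + real T - 1) * (P * (x * (1 - \<theta> n)))"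
        unfolding Nn \<xi>_def nP(1)[symmetric] by (simp add: algebra_simps)
      also have "\<dots> \<le> (real (S n) + real T - 1) * (real n * m) - real (S n) * (P * (x * (1 - \<theta> n)))"
        using T xth P by (intro diff_left_mono mult_right_mono) auto
      also have "\<dots> - real (S n) * ln (real (M n)) \<le>
          (real (S n) + real T - 1) * (real n * m) - real (S n) * (P * (x * (1 - \<theta> n)))
            - real (S n) * (real n * m - \<beta> * P - ln 2)"
        using Mn by (intro diff_left_mono mult_left_mono) (auto simp: m_def P_def)
      also have "\<dots> = (real T - 1) * (real n * m) - real (S n) * (P * w n)"
        unfolding w_def using nP(2) by (simp add: algebra_simps)
      also have "\<dots> \<le> real T * (real n * m) - (K * real n powr t) * (P * w n)"
        using SK P wpos m by (intro diff_mono mult_right_mono) auto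
      also have "\<dots> = real n * (real T * m - K * w n)"
        using nP(3) by (simp add: algebra_simps)
      also have "\<dots> \<le> real n * (real T * m - K * ((x - \<beta>) / 2))"
        using w x m T unfolding K_def by (intro mult_left_mono diff_left_mono) auto
      also have "\<dots> = - real n" using x by (simp add: K_def field_simps)
      finally have "c2 n \<le> exp (- real n)" by simp
      thus ?case using elim(3) by simp
    qed
  qed

  define h where "h n = - \<rho> * (\<alpha> * a n) + real (T * n) *
      (dens_cgf W (- (1 + \<rho>) * \<theta> n) - (1 + \<rho>) * dens_cgf W (- \<theta> n))" for n
  have ev3: "eventually (\<lambda>n. real (S n) * exp (h n) < 1 / 6) sequentially"
  proof -
    \<comment> \<open>The factor \<open>S n\<close> contributes \<open>ln (S n)\<close>, negligible
      against \<open>a n\<close>; what remains has a negative limit by the condition on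
      \<alpha>.\<close>
    have "(\<lambda>n. ln (real (S n)) / a n + (- \<rho> * \<alpha> + real T *
        (real n powr (2 * t) * dens_cgf W ((- (1 + \<rho>) * c) * real n powr - t) -
         (1 + \<rho>) * (real n powr (2 * t) * dens_cgf W ((- c) * real n powr - t))))) \<longlonglongrightarrow>
        0 + (- \<rho> * \<alpha> + real T * ((- (1 + \<rho>) * c)\<^sup>2 * (dens_var W / 2) - (1 + \<rho>) * ((- c)\<^sup>2 * (dens_var W / 2))))"
      using t by (intro tendsto_intros dens_cgf_scaled_limit S_small)
    also have "0 + (- \<rho> * \<alpha> + real T * ((- (1 + \<rho>) * c)\<^sup>2 * (dens_var W / 2) - (1 + \<rho>) * ((- c)\<^sup>2 * (dens_var W / 2)))) =
        \<rho> * (real T * (c\<^sup>2 * (dens_var W / 2)) * (1 + \<rho>) - \<alpha>)"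
      by (simp add: power2_eq_square field_simps)
    finally have "(\<lambda>n. (ln (real (S n)) + h n) / a n) \<longlonglongrightarrow> \<rho> * (real T * (c\<^sup>2 * (dens_var W / 2)) * (1 + \<rho>) - \<alpha>)"
    proof (rule Lim_transform_eventually)
      show "eventually (\<lambda>n. ln (real (S n)) / a n + (- \<rho> * \<alpha> + real T *
        (real n powr (2 * t) * dens_cgf W ((- (1 + \<rho>) * c) * real n powr - t) -
         (1 + \<rho>) * (real n powr (2 * t) * dens_cgf W ((- c) * real n powr - t)))) =
         (ln (real (S n)) + h n) / a n) sequentially"
        using eventually_gt_at_top[of 0]
      proof eventually_elim
        case (elim n)
        have an: "a n > 0" using elim by simp
        have th: "- (1 + \<rho>) * \<theta> n = (- (1 + \<rho>) * c) * real n powr - t" "- \<theta> n = (- c) * real n powr - t"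
          by (simp_all add: \<theta>_def)
        define A B where "A = dens_cgf W (- (1 + \<rho>) * \<theta> n)" and "B = dens_cgf W (- \<theta> n)"
        have "h n = a n * (- \<rho> * \<alpha> + real T * (real n powr (2 * t) * A - (1 + \<rho>) * (real n powr (2 * t) * B)))"
          unfolding h_def A_def[symmetric] B_def[symmetric] of_nat_mult
          by (subst (2) a_eq[OF elim]) (simp add: algebra_simps)
        thus ?case unfolding th[symmetric] A_def[symmetric] B_def[symmetric] using an
          by (simp add: add_divide_distrib)
      qed
    qed
    hence "(\<lambda>n. exp (ln (real (S n)) + h n)) \<longlonglongrightarrow> 0"
      by (rule exp_tendsto_0_of_rate[OF _ _ a_at_top]) (use \<rho> \<alpha> in \<open>simp add: mult_pos_neg\<close>)
    hence "eventually (\<lambda>n. exp (ln (real (S n)) + h n) < 1 / 6) sequentially" by (rule order_tendstoD) simp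
    thus ?thesis using ev_S1 by eventually_elim (simp add: exp_add)
  qed

  have ev\<theta>: "eventually (\<lambda>n. \<theta> n < 1) sequentially" using \<theta>_lim by (rule order_tendstoD) simp
  from ev1 ev2 ev3 ev\<theta> ev_S1 show ?thesis
  proof eventually_elim
    case (elim n)
    show ?case
    proof (intro allI impI)
      fix \<epsilon> \<phi> \<psi> assume code: "streaming_code W n (M n) \<epsilon> T (S n) \<phi> \<psi>"
      have "1 \<le> c1 n + c2 n + real (S n) * (exp (\<alpha> * a n) * \<epsilon> + exp (h n))"
        unfolding c1_def c2_def h_def N_def m_def
        by (rule streaming_converse[OF sym code]) (use elim(4) cpos cx \<rho> in \<open>auto simp: \<theta>_def \<mu>_def\<close>)
      \<comment> \<open>Three terms below 1/6 leave at least 1/2 for the error probability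
        term.\<close>
      hence "1 / 2 \<le> real (S n) * (exp (\<alpha> * a n) * \<epsilon>)"
        using elim(1-3) by (simp add: distrib_left)
      thus "exp (- \<alpha> * a n) / (2 * real (S n)) \<le> \<epsilon>"
        using elim(5) by (simp add: exp_minus field_simps)
    qed
  qed
qed

text \<open>One \<eta> serves both as \<rho> and as the relative excess of \<open>c\<close> over
  \<open>\<beta> / v\<close>; the exponent required of \<alpha> tends to \<open>rate\<close> as
  \<eta> decreases to 0.\<close>

lemma converse_rate:
  assumes "rate < \<alpha>"
  shows "eventually (\<lambda>n. \<forall>\<epsilon> \<phi> \<psi>. streaming_code W n (M n) \<epsilon> T (S n) \<phi> \<psi> \<longrightarrow>
    exp (- \<alpha> * a n) / (2 * real (S n)) \<le> \<epsilon>) sequentially"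
proof -
  define f where "f \<eta> = real T * ((\<beta> / dens_var W * (1 + \<eta>))\<^sup>2 * (dens_var W / 2)) * (1 + \<eta>)" for \<eta> :: real
  have "(f \<longlongrightarrow> f 0) (at_right 0)" unfolding f_def by (intro tendsto_intros)
  moreover have "f 0 = rate" using var by (simp add: f_def rate_def power2_eq_square field_simps)
  ultimately have "eventually (\<lambda>\<eta>. f \<eta> < \<alpha>) (at_right 0)" using assms by (auto dest: order_tendstoD)
  moreover have "eventually (\<lambda>\<eta>. 0 < \<eta>) (at_right (0::real))" by (rule eventually_at_right_less)
  ultimately have "eventually (\<lambda>\<eta>. f \<eta> < \<alpha> \<and> 0 < \<eta>) (at_right 0)" by eventually_elim simp
  then obtain \<eta> where \<eta>: "f \<eta> < \<alpha>" "0 < \<eta>"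
    using eventually_happens'[of "at_right (0::real)"] by auto
  show ?thesis
    by (rule converse_rate_aux[of "\<beta> / dens_var W * (1 + \<eta>)" \<eta>])
      (use \<eta> \<beta> var in \<open>auto simp: f_def field_simps\<close>)
qed

theorem optimal_error_rate: "(\<lambda>n. - ln (optimal_error W n (M n) T (S n)) / a n) \<longlonglongrightarrow> rate"
proof -
  define opt where "opt n = optimal_error W n (M n) T (S n)" for n
  obtain g where g: "g \<longlonglongrightarrow> rate" "eventually (\<lambda>n. \<exists>\<epsilon> \<phi> \<psi>. streaming_code W n (M n) \<epsilon> T (S n) \<phi> \<psi> \<and>
     0 < \<epsilon> \<and> g n \<le> - ln \<epsilon> / a n) sequentially"
    using achievability_rate by blast
  have bounds: "eventually (\<lambda>n. g n \<le> - ln (opt n) / a n \<and>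
      - ln (opt n) / a n \<le> \<alpha> + ln (2 * real (S n)) / a n) sequentially" if "rate < \<alpha>" for \<alpha>
    using g(2) converse_rate[OF that] ev_S1 eventually_gt_at_top[of 0]
  proof eventually_elim
    case (elim n)
    let ?E = "{\<epsilon>. \<exists>\<phi> \<psi>. streaming_code W n (M n) \<epsilon> T (S n) \<phi> \<psi>}"
    obtain \<epsilon> where \<epsilon>: "\<epsilon> \<in> ?E" "0 < \<epsilon>" "g n \<le> - ln \<epsilon> / a n" using elim(1) by blast
    define lb where "lb = exp (- \<alpha> * a n) / (2 * real (S n))"
    have lb: "0 < lb" "\<And>e. e \<in> ?E \<Longrightarrow> lb \<le> e" using elim(2,3) by (auto simp: lb_def)
    have opt: "opt n = Inf ?E" by (simp add: opt_def optimal_error_def)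
    \<comment> \<open>Achievability makes the set of error levels nonempty and the converse bounds
      it below by \<open>lb > 0\<close>, so the infimum is positive and its logarithm is
      genuine.\<close>
    have "lb \<le> opt n" unfolding opt using \<epsilon>(1) lb(2) by (intro cInf_greatest) auto
    have "opt n \<le> \<epsilon>" unfolding opt using \<epsilon>(1) lb(2) by (intro cInf_lower bdd_belowI[of _ lb]) auto
    have pos: "opt n > 0" using \<open>lb \<le> opt n\<close> lb(1) by linarith
    have an: "a n > 0" using elim(4) by simp
    have "ln (opt n) \<le> ln \<epsilon>" using \<open>opt n \<le> \<epsilon>\<close> pos by simp
    hence "- ln \<epsilon> / a n \<le> - ln (opt n) / a n" using an by (simp add: divide_right_mono)
    moreover have "ln lb \<le> ln (opt n)" using \<open>lb \<le> opt n\<close> lb(1) by simp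
    hence "- ln (opt n) \<le> \<alpha> * a n + ln (2 * real (S n))"
      using elim(3) by (simp add: lb_def ln_div)
    hence "- ln (opt n) / a n \<le> \<alpha> + ln (2 * real (S n)) / a n"
      using an by (simp add: field_simps)
    ultimately show ?case using \<epsilon>(3) by linarith
  qed
  have "(\<lambda>n. - ln (opt n) / a n) \<longlonglongrightarrow> rate"
  proof (rule order_tendstoI)
    fix l assume "l < rate"
    from order_tendstoD(1)[OF g(1) this] bounds[of "rate + 1", simplified]
    show "eventually (\<lambda>n. l < - ln (opt n) / a n) sequentially" by eventually_elim simp
  next
    fix u assume u: "rate < u"
    have "eventually (\<lambda>n. ln (2 * real (S n)) / a n < (u - rate) / 2) sequentially"
      by (rule order_tendstoD[OF S_small']) (use u in simp)
    moreover have "rate < (rate + u) / 2" using u by simp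
    note bounds[OF this]
    ultimately show "eventually (\<lambda>n. - ln (opt n) / a n < u) sequentially"
      by eventually_elim (simp add: field_simps)
  qed
  thus ?thesis unfolding opt_def .
qed

end

text \<open>The factor \<open>log b (exp 1)\<close> is a matter of units. In nats the exponent is
  \<open>T * \<beta>^2 / (2 * v)\<close> with \<open>\<beta> = ln b\<close> and
  \<open>v = \<beta>^2 * dispersion b W\<close>; division by \<beta>, for logarithms to base
  \<open>b\<close>, leaves \<open>T / (2 * dispersion b W)\<close> divided by \<open>ln b\<close>.
  The factor is 1 for \<open>b = exp 1\<close>.\<close>

theorem theorem1:
  fixes W :: "'x::finite \<Rightarrow> 'y::finite pmf"
    and T :: nat and b t :: real and M S :: "nat \<Rightarrow> nat"
  assumes "b > 1"
    and "output_symmetric W"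
    and "dispersion b W > 0"
    and "T \<ge> 1"
    and "0 < t" and "t < 1 / 3"
    and "\<forall>n\<ge>1. \<bar>real (M n) - b powr (real n * capacity b W - real n powr (1 - t))\<bar> < 1"
    and "(\<lambda>n. real (S n)) \<in> \<omega>(\<lambda>n. real n powr t)"
    and "(\<lambda>n. log b (real (S n))) \<in> o(\<lambda>n. real n powr (1 - 2 * t))"
  shows "(\<lambda>n. - (1 / real n powr (1 - 2 * t)) * log b (optimal_error W n (M n) T (S n)))
           \<longlonglongrightarrow> real T / (2 * dispersion b W) * log b (exp 1)"
proof -
  define \<beta> where "\<beta> = ln b"
  have \<beta>: "\<beta> > 0" using assms(1) by (simp add: \<beta>_def)
  have disp: "dispersion b W = dens_var W / \<beta>\<^sup>2"
    unfolding \<beta>_def by (rule dispersion_eq[OF assms(2,1)])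
  have cap: "capacity b W = dens_mean W / \<beta>"
    unfolding \<beta>_def by (rule capacity_eq[OF assms(2,1)])
  interpret moderate_regime W T \<beta> t M S
  proof
    show "dens_var W > 0" using assms(3) \<beta> by (simp add: disp zero_less_divide_iff)
    have "b powr (real n * capacity b W - real n powr (1 - t)) =
        exp (real n * dens_mean W - \<beta> * real n powr (1 - t))" for n
      using assms(1) \<beta> by (simp add: powr_def cap flip: \<beta>_def) (simp add: field_simps)
    thus "\<forall>n\<ge>1. \<bar>real (M n) - exp (real n * dens_mean W - \<beta> * real n powr (1 - t))\<bar> < 1"
      using assms(7) by simp
    have "(\<lambda>n. \<beta> * (log b (real (S n)) / real n powr (1 - 2 * t))) \<longlonglongrightarrow> \<beta> * 0"
      by (intro tendsto_intros smalloD_tendsto[OF assms(9)])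
    thus "(\<lambda>n. ln (real (S n)) / real n powr (1 - 2 * t)) \<longlonglongrightarrow> 0"
      using \<beta> by (simp add: log_def flip: \<beta>_def)
  qed (use assms \<beta> in auto)
  have "(\<lambda>n. (- ln (optimal_error W n (M n) T (S n)) / real n powr (1 - 2 * t)) / \<beta>) \<longlonglongrightarrow> rate / \<beta>"
    by (intro tendsto_divide optimal_error_rate tendsto_const) (use \<beta> in simp)
  moreover have "rate / \<beta> = real T / (2 * dispersion b W) * log b (exp 1)"
    using \<beta> var by (simp add: rate_def disp log_def power2_eq_square flip: \<beta>_def)
  ultimately show ?thesis by (simp add: log_def mult.commute flip: \<beta>_def)
qed

end
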